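(* Let $\kappa\ge\Delta\ge 2$. For every fixed (oblivious) update sequence on a general (unrooted) forest of maximum degree at most $\Delta$ starting from the empty forest, and every $t\ge 0$, the random coloring maintained by {\textsc{DistMaint}} after $t$ updates is distributed uniformly over all proper edge colorings of the current forest with colors $[\kappa]$.
   Context: Updates are insertions of edges joining two distinct trees and deletions of edges; maximum degree stays at most $\Delta$. $A(x)$ = colors of $[\kappa]$ not used on edges at $x$. {\textsc{DistMaint}} keeps a designated root in every tree (initially each vertex is a root; rerooting changes only designation, not colors). FixForbidden$(v,\alpha,\beta)$: if no child edge of $v$ has color $\beta$ stop; else recolor that child edge $(v,w)$ to $\alpha$ and call FixForbidden$(w,\beta,\alpha)$. Insertion of $(u,v)$ with trees $T_u,T_v$: if both have at most $\Delta$ edges name endpoints so $\deg(v)\le\deg(u)$, else so $|E(T_v)|\le|E(T_u)|$; reroot $T_v$ at $v$, make $v$ a child of $u$, choose $\beta$ uniformly from $A(u)$ and color $(u,v)$ by $\beta$; if no child edge of $v$ has color $\beta$ stop, else for that edge $(v,w)$ choose $\alpha$ uniformly from $A(v)$, recolor $(v,w)$ to $\alpha$ and call FixForbidden$(w,\beta,\alpha)$. Deletion of $(u,v)$ where (in the current rooting) $u$ is the parent of $v$ and the color is $\alpha$: delete it; with $\ell$ the number of children of $v$, with probability $(\kappa-\ell)/\kappa$ stop; otherwise pick a uniformly random child $w$ of $v$, let $\beta=\mathrm{color}(v,w)$, recolor $(v,w)$ to $\alpha$ and call FixForbidden$(w,\beta,\alpha)$. Random choices are independent. *)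

theory Defs
  imports "HOL-Probability.Probability"
begin

text \<open>
  The vertices are the elements of an arbitrary type, an edge is the set of its two ends, and a
  forest is given by its edge set. A partial edge coloring is a map from edges to colors.
\<close>

datatype 'v update = Insert 'v 'v | Delete 'v 'v

definition adj :: "'v set set \<Rightarrow> 'v rel" where
  "adj E = {(x, y). {x, y} \<in> E}"

definition component :: "'v set set \<Rightarrow> 'v \<Rightarrow> 'v set" where
  "component E x = {y. (x, y) \<in> (adj E)\<^sup>*}"

definition tree_edges :: "'v set set \<Rightarrow> 'v \<Rightarrow> 'v set set" where
  "tree_edges E x = {e \<in> E. e \<subseteq> component E x}"

definition degree :: "'v set set \<Rightarrow> 'v \<Rightarrow> nat" where
  "degree E x = card {e \<in> E. x \<in> e}"

fun apply_update :: "'v update \<Rightarrow> 'v set set \<Rightarrow> 'v set set" where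
  "apply_update (Insert u v) E = insert {u, v} E"
| "apply_update (Delete u v) E = E - {{u, v}}"

primrec forest :: "'v update list \<Rightarrow> nat \<Rightarrow> 'v set set" where
  "forest us 0 = {}"
| "forest us (Suc t) = apply_update (us ! t) (forest us t)"

text \<open>
  An insertion joins two distinct trees (so in particular \<open>u \<noteq> v\<close>), hence a valid sequence
  started from the empty forest only ever produces finite forests.
\<close>

fun valid_update :: "nat \<Rightarrow> 'v set set \<Rightarrow> 'v update \<Rightarrow> bool" where
  "valid_update \<Delta> E (Insert u v) \<longleftrightarrow>
     v \<notin> component E u \<and> (\<forall>x. degree (insert {u, v} E) x \<le> \<Delta>)"
| "valid_update \<Delta> E (Delete u v) \<longleftrightarrow> {u, v} \<in> E"

definition valid_updates :: "nat \<Rightarrow> 'v update list \<Rightarrow> bool" where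
  "valid_updates \<Delta> us \<longleftrightarrow> (\<forall>t < length us. valid_update \<Delta> (forest us t) (us ! t))"

type_synonym 'v coloring = "'v set \<rightharpoonup> nat"

definition proper_colorings :: "nat \<Rightarrow> 'v set set \<Rightarrow> 'v coloring set" where
  "proper_colorings \<kappa> E = {c. dom c = E \<and> ran c \<subseteq> {1..\<kappa>} \<and>
     (\<forall>e \<in> E. \<forall>f \<in> E. e \<noteq> f \<and> e \<inter> f \<noteq> {} \<longrightarrow> c e \<noteq> c f)}"

definition available :: "nat \<Rightarrow> 'v coloring \<Rightarrow> 'v \<Rightarrow> nat set" where
  "available \<kappa> c x = {1..\<kappa>} - {a. \<exists>e. x \<in> e \<and> c e = Some a}"

definition simple_path :: "'v set set \<Rightarrow> 'v list \<Rightarrow> bool" where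
  "simple_path E p \<longleftrightarrow> distinct p \<and> successively (\<lambda>x y. {x, y} \<in> E) p"

text \<open>
  A rooting is the set \<open>R\<close> of designated roots, one in every tree. The vertex \<open>w\<close> is a child of
  \<open>v\<close> when the path from the root of its tree to \<open>w\<close> ends with the edge from \<open>v\<close> to \<open>w\<close>.
\<close>

definition child :: "'v set set \<Rightarrow> 'v set \<Rightarrow> 'v \<Rightarrow> 'v \<Rightarrow> bool" where
  "child E R v w \<longleftrightarrow> (\<exists>q. simple_path E (q @ [v, w]) \<and> hd (q @ [v, w]) \<in> R)"

text \<open>
  The recursion descends in the rooted forest, so it terminates on every finite forest. At each
  call at most one child edge of \<open>v\<close> has color \<open>\<beta>\<close>, as the coloring is proper below \<open>v\<close>.
\<close>

partial_function (tailrec) fix_forbidden ::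
  "'v set set \<Rightarrow> 'v set \<Rightarrow> 'v \<Rightarrow> nat \<Rightarrow> nat \<Rightarrow> 'v coloring \<Rightarrow> 'v coloring" where
  "fix_forbidden E R v \<alpha> \<beta> c =
     (if \<nexists>w. child E R v w \<and> c {v, w} = Some \<beta> then c
      else let w = (THE w. child E R v w \<and> c {v, w} = Some \<beta>)
           in fix_forbidden E R w \<beta> \<alpha> (c({v, w} \<mapsto> \<alpha>)))"

text \<open>
  The size condition only determines the order of the ends up to ties. Ties are broken by an
  arbitrary rule, which must not look at the colors.
\<close>

definition name_ends ::
  "nat \<Rightarrow> ('v \<Rightarrow> 'v \<Rightarrow> bool) \<Rightarrow> 'v set set \<Rightarrow> 'v \<Rightarrow> 'v \<Rightarrow> 'v \<times> 'v" where
  "name_ends \<Delta> tie E u v =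
     (let m = (if card (tree_edges E u) \<le> \<Delta> \<and> card (tree_edges E v) \<le> \<Delta>
               then degree E else (\<lambda>x. card (tree_edges E x)))
      in if m v < m u \<or> (m v = m u \<and> tie u v) then (u, v) else (v, u))"

type_synonym 'v state = "'v set set \<times> 'v set \<times> 'v coloring"

text \<open>
  Rerooting the tree of \<open>v\<close> at \<open>v\<close> and then making \<open>v\<close> a child of \<open>u\<close> leaves no root in that tree,
  while the root of the tree of \<open>u\<close> becomes the root of the joint tree.
\<close>

definition insert_step ::
  "nat \<Rightarrow> nat \<Rightarrow> ('v \<Rightarrow> 'v \<Rightarrow> bool) \<Rightarrow> 'v \<Rightarrow> 'v \<Rightarrow> 'v state \<Rightarrow> 'v state pmf" where
  "insert_step \<kappa> \<Delta> tie x y = (\<lambda>(E, R, c).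
     let (u, v) = name_ends \<Delta> tie E x y;
         E' = insert {u, v} E;
         R' = R - component E v
     in do {
       \<beta> \<leftarrow> pmf_of_set (available \<kappa> c u);
       let c' = c({u, v} \<mapsto> \<beta>);
       if \<nexists>w. child E' R' v w \<and> c' {v, w} = Some \<beta> then return_pmf (E', R', c')
       else do {
         let w = (THE w. child E' R' v w \<and> c' {v, w} = Some \<beta>);
         \<alpha> \<leftarrow> pmf_of_set (available \<kappa> c' v);
         return_pmf (E', R', fix_forbidden E' R' w \<beta> \<alpha> (c'({v, w} \<mapsto> \<alpha>)))
       }
     })"

text \<open>
  After a deletion the lower end \<open>v\<close> of the deleted edge becomes the root of its new tree. If \<open>v\<close>
  has no child, then the algorithm stops with probability 1.
\<close>

definition delete_step :: "nat \<Rightarrow> 'v \<Rightarrow> 'v \<Rightarrow> 'v state \<Rightarrow> 'v state pmf" where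
  "delete_step \<kappa> x y = (\<lambda>(E, R, c).
     let (u, v) = (if child E R x y then (x, y) else (y, x));
         \<alpha> = the (c {u, v});
         E' = E - {{u, v}};
         R' = insert v R;
         c' = c({u, v} := None);
         l = card {w. child E' R' v w}
     in do {
       stop \<leftarrow> bernoulli_pmf ((real \<kappa> - real l) / real \<kappa>);
       if stop then return_pmf (E', R', c')
       else do {
         w \<leftarrow> pmf_of_set {w. child E' R' v w};
         let \<beta> = the (c' {v, w});
         return_pmf (E', R', fix_forbidden E' R' w \<beta> \<alpha> (c'({v, w} \<mapsto> \<alpha>)))
       }
     })"

fun dm_step ::
  "nat \<Rightarrow> nat \<Rightarrow> ('v \<Rightarrow> 'v \<Rightarrow> bool) \<Rightarrow> 'v update \<Rightarrow> 'v state \<Rightarrow> 'v state pmf" where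
  "dm_step \<kappa> \<Delta> tie (Insert x y) = insert_step \<kappa> \<Delta> tie x y"
| "dm_step \<kappa> \<Delta> tie (Delete x y) = delete_step \<kappa> x y"

text \<open>
  The tie-breaking rule may depend on all previous updates. As these determine the current rooted
  forest, this covers every deterministic rule that ignores the colors.
\<close>

primrec dist_maint ::
  "nat \<Rightarrow> nat \<Rightarrow> ('v update list \<Rightarrow> 'v \<Rightarrow> 'v \<Rightarrow> bool) \<Rightarrow> 'v update list \<Rightarrow> nat \<Rightarrow> 'v state pmf" where
  "dist_maint \<kappa> \<Delta> tie us 0 = return_pmf ({}, UNIV, Map.empty)"
| "dist_maint \<kappa> \<Delta> tie us (Suc t) =
     bind_pmf (dist_maint \<kappa> \<Delta> tie us t) (dm_step \<kappa> \<Delta> (tie (take t us)) (us ! t))"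

definition dist_maint_coloring ::
  "nat \<Rightarrow> nat \<Rightarrow> ('v update list \<Rightarrow> 'v \<Rightarrow> 'v \<Rightarrow> bool) \<Rightarrow> 'v update list \<Rightarrow> nat \<Rightarrow> 'v coloring pmf" where
  "dist_maint_coloring \<kappa> \<Delta> tie us t = map_pmf (\<lambda>(E, R, c). c) (dist_maint \<kappa> \<Delta> tie us t)"

end

theory Submission
  imports Defs
begin

text \<open>
  The recoloring done by an update swaps two colors along the Kempe chain that starts with an edge
  \<open>{v, w}\<close> and descends into the subtree of \<open>w\<close>. The swap does not change the chain, so it is an
  involution, and the recoloring of an insertion at \<open>u\<close>, \<open>v\<close> is undone by that of a deletion.
  Let \<open>k\<close> be the number of colors available at \<open>u\<close> and \<open>l\<close> the number of children of \<open>v\<close>,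
  both without the edge \<open>{u, v}\<close>. An insertion takes \<open>c\<close> to \<open>d\<close> with probability \<open>1 / k\<close> or
  \<open>1 / (k (\<kappa> - l))\<close>, according to whether a chain is swapped; a deletion takes \<open>d\<close> to \<open>c\<close> with
  probability \<open>(\<kappa> - l) / \<kappa>\<close> or \<open>1 / \<kappa>\<close> respectively. The ratio is the same in both cases: this
  is detailed balance between the two uniform distributions, hence either kernel maps one uniform
  distribution to the other.
\<close>

section \<open>Rooted forests\<close>

text \<open>A rooted forest is encoded by its parent-to-child arcs. The converse being single-valued
  means that a vertex has at most one parent, and the roots are exactly \<open>- Range C\<close>,
  isolated vertices included.\<close>

definition arborescence :: "'v rel \<Rightarrow> bool" where
  "arborescence C \<longleftrightarrow> finite C \<and> acyclic C \<and> single_valued (C\<inverse>)"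

definition edges :: "'v rel \<Rightarrow> 'v set set" where
  "edges C = (\<lambda>(x, y). {x, y}) ` C"

lemma edges_iff: "{x, y} \<in> edges C \<longleftrightarrow> (x, y) \<in> C \<or> (y, x) \<in> C"
  by (force simp: edges_def doubleton_eq_iff image_iff)

lemma edges_cases:
  assumes "e \<in> edges C"
  obtains x y where "e = {x, y}" "(x, y) \<in> C"
  using assms by (auto simp: edges_def)

lemma edges_insert: "edges (insert (x, y) C) = insert {x, y} (edges C)"
  by (simp add: edges_def)

lemma arborescence_parent:
  "arborescence C \<Longrightarrow> (x, z) \<in> C \<Longrightarrow> (y, z) \<in> C \<Longrightarrow> x = y"
  by (auto simp: arborescence_def single_valued_def)

lemma finite_edges: "arborescence C \<Longrightarrow> finite (edges C)"
  by (simp add: arborescence_def edges_def)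

lemma arborescence_irrefl: "arborescence C \<Longrightarrow> (x, x) \<notin> C"
  by (auto simp: arborescence_def acyclic_def)

lemma arborescence_no_cycle: "arborescence C \<Longrightarrow> (x, y) \<in> C \<Longrightarrow> (y, x) \<notin> C\<^sup>*"
  unfolding arborescence_def acyclic_def by (meson rtrancl_into_trancl2)

lemma arborescence_subset: "arborescence C \<Longrightarrow> D \<subseteq> C \<Longrightarrow> arborescence D"
  unfolding arborescence_def
  by (meson acyclic_subset converse_mono finite_subset single_valued_subset)

lemma edge_determines_child:
  "arborescence C \<Longrightarrow> (x, y) \<in> C \<Longrightarrow> (x', y') \<in> C \<Longrightarrow> {x, y} = {x', y'} \<Longrightarrow> x = x' \<and> y = y'"
  using arborescence_no_cycle[of C x y] by (auto simp: doubleton_eq_iff)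

lemma rtrancl_root: "r \<notin> Range C \<Longrightarrow> (x, r) \<in> C\<^sup>* \<Longrightarrow> x = r"
  by (metis RangeI rtranclE)

text \<open>A root has no parent, so the first step goes down. A step up right after a step down
  would return to the unique parent and repeat a vertex of the path.\<close>

lemma simple_path_descends:
  assumes C: "arborescence C"
  shows "simple_path (edges C) p \<Longrightarrow> hd p \<notin> Range C \<Longrightarrow> successively (\<lambda>x y. (x, y) \<in> C) p"
proof (induction p rule: rev_induct)
  case Nil
  then show ?case by simp
next
  case (snoc z p)
  show ?case
  proof (cases p rule: rev_cases)
    case Nil
    then show ?thesis by simp
  next
    case (snoc p' y)
    have desc: "successively (\<lambda>x y. (x, y) \<in> C) p"
      using snoc.prems snoc.IH \<open>p = p' @ [y]\<close>
      by (auto simp: simple_path_def successively_append_iff hd_append split: if_splits)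
    have "{y, z} \<in> edges C"
      using snoc.prems(1) \<open>p = p' @ [y]\<close> by (simp add: simple_path_def successively_append_iff)
    moreover have "(z, y) \<notin> C"
    proof
      assume zy: "(z, y) \<in> C"
      show False
      proof (cases p' rule: rev_cases)
        case Nil
        then show False using zy snoc.prems(2) \<open>p = p' @ [y]\<close> by auto
      next
        case (snoc p'' x)
        then have "(x, y) \<in> C"
          using desc \<open>p = p' @ [y]\<close> by (simp add: successively_append_iff)
        then have "x = z" using zy C arborescence_parent by metis
        then show False
          using snoc.prems(1) \<open>p = p' @ [y]\<close> snoc by (simp add: simple_path_def)
      qed
    qed
    ultimately have "(y, z) \<in> C" by (simp add: edges_iff)
    then show ?thesis
      using desc \<open>p = p' @ [y]\<close> by (simp add: successively_append_iff)
  qed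
qed

text \<open>Induction from the parent to the child. The bound on \<open>set q\<close> is carried
  along because acyclicity then keeps the next vertex off the path, so the extended path stays
  simple.\<close>

lemma path_from_root:
  assumes C: "arborescence C"
  shows "\<exists>q. simple_path (edges C) (q @ [x]) \<and> hd (q @ [x]) \<notin> Range C \<and> set q \<subseteq> {y. (y, x) \<in> C\<^sup>+}"
proof -
  have "wf C" using C finite_acyclic_wf by (auto simp: arborescence_def)
  then show ?thesis
  proof (induction x rule: wf_induct_rule)
    case (less x)
    show ?case
    proof (cases "x \<in> Range C")
      case False
      then show ?thesis by (intro exI[of _ "[]"]) (simp add: simple_path_def)
    next
      case True
      then obtain p where p: "(p, x) \<in> C" by blast
      then obtain q where q: "simple_path (edges C) (q @ [p])" "hd (q @ [p]) \<notin> Range C"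
        "set q \<subseteq> {y. (y, p) \<in> C\<^sup>+}" using less.IH by blast
      have anc: "set (q @ [p]) \<subseteq> {y. (y, x) \<in> C\<^sup>+}"
        using q(3) p by (auto intro: trancl_into_trancl)
      moreover have "x \<notin> set (q @ [p])"
        using anc C by (auto simp: arborescence_def acyclic_def)
      ultimately have "simple_path (edges C) ((q @ [p]) @ [x])"
        using q(1) p by (auto simp: simple_path_def successively_append_iff edges_iff)
      then show ?thesis
        using anc q(2) by (intro exI[of _ "q @ [p]"]) (auto simp: hd_append)
    qed
  qed
qed

text \<open>This replaces the path-based notion of child in the algorithm by membership in the arc
  relation, on which all later arguments run.\<close>

lemma child_iff:
  assumes C: "arborescence C"
  shows "child (edges C) (- Range C) x y \<longleftrightarrow> (x, y) \<in> C"
proof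
  assume "child (edges C) (- Range C) x y"
  then obtain q where "simple_path (edges C) (q @ [x, y])" "hd (q @ [x, y]) \<notin> Range C"
    by (auto simp: child_def)
  from simple_path_descends[OF C this] show "(x, y) \<in> C"
    by (simp add: successively_append_iff)
next
  assume xy: "(x, y) \<in> C"
  obtain q where q: "simple_path (edges C) (q @ [x])" "hd (q @ [x]) \<notin> Range C"
    "set q \<subseteq> {z. (z, x) \<in> C\<^sup>+}" using path_from_root[OF C] by blast
  have "y \<notin> set (q @ [x])"
    using q(3) xy arborescence_no_cycle[OF C xy] by (auto dest: trancl_into_rtrancl)
  then have "simple_path (edges C) (q @ [x, y])"
    using q(1) xy by (auto simp: simple_path_def successively_append_iff edges_iff)
  moreover have "hd (q @ [x, y]) \<notin> Range C" using q(2) by (cases q) auto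
  ultimately show "child (edges C) (- Range C) x y" by (auto simp: child_def)
qed

section \<open>Components of a forest and change of root\<close>

lemma sym_adj: "sym (adj E)"
  by (auto simp: adj_def sym_def insert_commute)

lemma component_refl: "x \<in> component E x"
  by (simp add: component_def)

lemma component_sym: "y \<in> component E x \<Longrightarrow> x \<in> component E y"
  unfolding component_def by (simp add: symD[OF sym_rtrancl[OF sym_adj]])

lemma component_eqI: "{x, y} \<in> E \<Longrightarrow> component E x = component E y"
proof -
  assume "{x, y} \<in> E"
  then have "(x, y) \<in> adj E" "(y, x) \<in> adj E" by (auto simp: adj_def insert_commute)
  then show ?thesis unfolding component_def by (blast intro: converse_rtrancl_into_rtrancl)
qed

lemma descendant_component: "(x, y) \<in> C\<^sup>* \<Longrightarrow> y \<in> component (edges C) x"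
proof -
  have "C \<subseteq> adj (edges C)" by (auto simp: adj_def edges_iff)
  then show "(x, y) \<in> C\<^sup>* \<Longrightarrow> ?thesis"
    unfolding component_def using rtrancl_mono by blast
qed

text \<open>Follow an undirected path from \<open>r\<close>. A step up from \<open>y\<close> reaches
  the unique parent of \<open>y\<close>, which is already the last but one vertex on the directed
  path from \<open>r\<close> to \<open>y\<close>.\<close>

lemma component_root:
  assumes C: "arborescence C" and r: "r \<notin> Range C" and y: "y \<in> component (edges C) r"
  shows "(r, y) \<in> C\<^sup>*"
proof -
  have "(r, y) \<in> (adj (edges C))\<^sup>*" using y by (simp add: component_def)
  then show ?thesis
  proof (induction rule: rtrancl_induct)
    case base
    then show ?case by simp
  next
    case (step y z)
    then consider "(y, z) \<in> C" | "(z, y) \<in> C" by (auto simp: adj_def edges_iff)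
    then show ?case
    proof cases
      case 1
      then show ?thesis using step.IH by auto
    next
      case 2
      then have "y \<noteq> r" using r by auto
      then obtain x where "(r, x) \<in> C\<^sup>*" "(x, y) \<in> C" using step.IH by (metis rtranclE)
      then show ?thesis using 2 arborescence_parent[OF C] by metis
    qed
  qed
qed

text \<open>Induction down the tree: first reroot at the parent \<open>p\<close> of
  \<open>v\<close>, after which only the arc from \<open>p\<close> to \<open>v\<close> has to be
  reversed. Edges do not change, hence neither do the colorings.\<close>

lemma reroot_exists:
  assumes C: "arborescence C"
  shows "\<exists>D. arborescence D \<and> edges D = edges C \<and>
    - Range D = insert v (- Range C - component (edges C) v)"
proof -
  have "wf C" using C finite_acyclic_wf by (auto simp: arborescence_def)
  then show ?thesis
  proof (induction v rule: wf_induct_rule)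
    case (less v)
    show ?case
    proof (cases "v \<in> Range C")
      case False
      have "- Range C = insert v (- Range C - component (edges C) v)"
      proof -
        have "r = v" if r: "r \<notin> Range C" "r \<in> component (edges C) v" for r
          using rtrancl_root[OF r(1) component_root[OF C False r(2)]] by simp
        then show ?thesis using False by auto
      qed
      then show ?thesis using C by metis
    next
      case True
      then obtain p where p: "(p, v) \<in> C" by blast
      then obtain D where D: "arborescence D" "edges D = edges C"
        "- Range D = insert p (- Range C - component (edges C) p)" using less.IH by blast
      have comp: "component (edges C) p = component (edges C) v"
        using p by (intro component_eqI) (simp add: edges_iff)
      have root: "p \<notin> Range D" using D(3) by blast
      \<comment> \<open>Since \<open>p\<close> is a root of \<open>D\<close>, the edge between
        \<open>p\<close> and \<open>v\<close> can only point away from \<open>p\<close>.\<close>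
      then have pv: "(p, v) \<in> D" using D(2) p by (metis Range.intros edges_iff)
      define D0 where "D0 = D - {(p, v)}"
      define D' where "D' = insert (v, p) D0"
      have D0: "arborescence D0" using D(1) by (rule arborescence_subset) (auto simp: D0_def)
      have DD0: "D = insert (p, v) D0" using pv by (auto simp: D0_def)
      have v0: "v \<notin> Range D0" using arborescence_parent[OF D(1) pv] by (auto simp: D0_def)
      have p0: "p \<notin> Range D0" using root by (auto simp: D0_def)
      have "p \<noteq> v" using p C arborescence_irrefl by metis
      \<comment> \<open>A cycle through the reversed arc \<open>(v, p)\<close> would need a path
        from \<open>p\<close> to \<open>v\<close> in \<open>D0\<close>, where \<open>v\<close> has
        no parent.\<close>
      then have "(p, v) \<notin> D0\<^sup>*" using rtrancl_root[OF v0] by blast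
      then have "arborescence D'"
        using D0 p0 by (auto simp: D'_def arborescence_def single_valued_def)
      moreover have "edges D' = edges C"
        unfolding D'_def edges_insert D(2)[symmetric] DD0 by (simp add: insert_commute)
      moreover have "- Range D' = insert v (- Range C - component (edges C) v)"
      proof -
        have "Range D = insert v (Range D0)" using DD0 by auto
        then have "- Range D' = insert v (- Range D - {p})"
          using v0 \<open>p \<noteq> v\<close> by (auto simp: D'_def)
        also have "\<dots> = insert v (- Range C - component (edges C) v)"
          unfolding D(3) comp[symmetric] using component_refl[of p "edges C"] by auto
        finally show ?thesis .
      qed
      ultimately show ?thesis by blast
    qed
  qed
qed

lemma arborescence_attach:
  assumes C: "arborescence C" and v: "v \<notin> Range C" and u: "u \<notin> component (edges C) v"
  shows "arborescence (insert (u, v) C)"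
proof -
  have "(v, u) \<notin> C\<^sup>*" using u descendant_component by metis
  then show ?thesis using C v by (auto simp: arborescence_def single_valued_def)
qed

section \<open>Kempe chains\<close>

definition recolor_on :: "'v set set \<Rightarrow> nat \<Rightarrow> nat \<Rightarrow> 'v coloring \<Rightarrow> 'v coloring" where
  "recolor_on S a b c = (\<lambda>e. if e \<in> S then map_option (Transposition.transpose a b) (c e) else c e)"

definition kempe_rel :: "'v rel \<Rightarrow> nat \<Rightarrow> nat \<Rightarrow> 'v coloring \<Rightarrow> 'v rel" where
  "kempe_rel C a b c = {(x, y) \<in> C. c {x, y} \<in> {Some a, Some b}}"

text \<open>The top edge \<open>{v, w}\<close> is kept apart from the chain, because
  \<open>fix_forbidden\<close> is called at \<open>w\<close> when that edge has already been
  recolored.\<close>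

definition kempe_below :: "'v rel \<Rightarrow> 'v \<Rightarrow> nat \<Rightarrow> nat \<Rightarrow> 'v coloring \<Rightarrow> 'v set set" where
  "kempe_below C w a b c =
     {{x, y} |x y. (w, x) \<in> (kempe_rel C a b c)\<^sup>* \<and> (x, y) \<in> kempe_rel C a b c}"

definition kempe :: "'v rel \<Rightarrow> 'v \<Rightarrow> 'v \<Rightarrow> nat \<Rightarrow> nat \<Rightarrow> 'v coloring \<Rightarrow> 'v coloring" where
  "kempe C v w a b c = recolor_on (insert {v, w} (kempe_below C w a b c)) a b c"

lemma kempe_rel_subset: "kempe_rel C a b c \<subseteq> C"
  by (auto simp: kempe_rel_def)

lemma kempe_rel_rtranclD: "(x, y) \<in> (kempe_rel C a b c)\<^sup>* \<Longrightarrow> (x, y) \<in> C\<^sup>*"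
  using rtrancl_mono[OF kempe_rel_subset] by blast

lemma kempe_rel_cong:
  assumes "\<And>x y. (x, y) \<in> C \<Longrightarrow> c {x, y} \<in> {Some a, Some b} \<longleftrightarrow> d {x, y} \<in> {Some a, Some b}"
  shows "kempe_rel C a b c = kempe_rel C a b d"
  using assms by (auto simp: kempe_rel_def)

lemma kempe_below_cong:
  "kempe_rel C a b c = kempe_rel C a b d \<Longrightarrow> kempe_below C w a b c = kempe_below C w a b d"
  by (simp add: kempe_below_def)

lemma kempe_below_commute: "kempe_below C w a b c = kempe_below C w b a c"
proof -
  have "kempe_rel C a b c = kempe_rel C b a c" by (auto simp: kempe_rel_def)
  then show ?thesis by (simp add: kempe_below_def)
qed

text \<open>Insertion and deletion name the two colors in opposite order, so undoing one by the
  other needs this symmetry besides the involution.\<close>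

lemma kempe_commute: "kempe C v w a b c = kempe C v w b a c"
  by (auto simp: kempe_def recolor_on_def fun_eq_iff kempe_below_commute[of C w b a] Transposition.transpose_commute)

text \<open>The swap leaves the set of edges colored \<open>a\<close> or \<open>b\<close> unchanged, hence also the chain.\<close>

lemma kempe_involution: "kempe C v w a b (kempe C v w a b c) = c"
proof -
  have "kempe_rel C a b (kempe C v w a b c) = kempe_rel C a b c"
    by (rule kempe_rel_cong) (auto simp: kempe_def recolor_on_def Transposition.transpose_def split: if_splits)
  then have "kempe_below C w a b (kempe C v w a b c) = kempe_below C w a b c"
    by (rule kempe_below_cong)
  then show ?thesis
    by (auto simp: kempe_def recolor_on_def fun_eq_iff option.map_comp comp_def option.map_ident)
qed

text \<open>Equality would force \<open>x = v\<close>, and then \<open>w\<close> reaches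
  \<open>v\<close> and closes a cycle with the arc \<open>(v, w)\<close>.\<close>

lemma edge_below_neq:
  assumes C: "arborescence C" and "(v, w) \<in> C" and "(w, x) \<in> C\<^sup>*" "(x, y) \<in> C"
  shows "{x, y} \<noteq> {v, w}"
  using edge_determines_child[OF C assms(4,2)] arborescence_no_cycle[OF C assms(2)] assms(3) by auto

lemma kempe_below_nmem:
  assumes "arborescence C" and "(v, w) \<in> C"
  shows "{v, w} \<notin> kempe_below C w a b c"
proof
  assume "{v, w} \<in> kempe_below C w a b c"
  then obtain x y where xy: "{v, w} = {x, y}" "(w, x) \<in> (kempe_rel C a b c)\<^sup>*" "(x, y) \<in> kempe_rel C a b c"
    unfolding kempe_below_def by blast
  then have "(x, y) \<in> C" using kempe_rel_subset by blast
  then show False using edge_below_neq[OF assms kempe_rel_rtranclD[OF xy(2)]] xy(1) by blast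
qed

text \<open>Induction down the tree. The call looks for a child edge of \<open>w\<close> colored
  \<open>a\<close> and turns it into \<open>b\<close>; that no child edge of \<open>w\<close> has
  color \<open>b\<close> is the invariant, with the colors exchanged at every level. Properness is
  required only below \<open>w\<close>, as the edge above has just been recolored, and
  \<open>E\<close>, \<open>R\<close> need to agree with \<open>C\<close> only there, so that the
  lemma serves the joined forest and the split one.\<close>

lemma fix_forbidden_eq_recolor:
  assumes C: "arborescence C"
    and "\<And>x y. (w, x) \<in> C\<^sup>* \<Longrightarrow> child E R x y \<longleftrightarrow> (x, y) \<in> C"
    and "\<And>z. (w, z) \<in> C \<Longrightarrow> d {w, z} \<noteq> Some b"
    and "\<And>x y z. (w, x) \<in> C\<^sup>* \<Longrightarrow> (x, y) \<in> C \<Longrightarrow> (y, z) \<in> C \<Longrightarrow> d {x, y} \<noteq> d {y, z}"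
    and "\<And>x y z. (w, x) \<in> C\<^sup>* \<Longrightarrow> (x, y) \<in> C \<Longrightarrow> (x, z) \<in> C \<Longrightarrow> y \<noteq> z \<Longrightarrow> d {x, y} \<noteq> d {x, z}"
    and "a \<noteq> b"
  shows "fix_forbidden E R w b a d = recolor_on (kempe_below C w a b d) a b d"
proof -
  have "wf (C\<inverse>)" using C finite_acyclic_wf_converse by (auto simp: arborescence_def)
  then show ?thesis using assms(2-6)
  proof (induction w arbitrary: a b d rule: wf_induct_rule)
    case (less w)
    note child = less.prems(1) and no_b = less.prems(2) and down = less.prems(3)
      and siblings = less.prems(4)
    have child_w: "child E R w y \<longleftrightarrow> (w, y) \<in> C" for y using child by blast
    show ?case
    proof (cases "\<exists>z. (w, z) \<in> C \<and> d {w, z} = Some a")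
      case False
      \<comment> \<open>Neither color occurs on a child edge of \<open>w\<close>, so the chain is
        empty and the recursion stops.\<close>
      then have none: "(w, y) \<notin> kempe_rel C a b d" for y using no_b by (auto simp: kempe_rel_def)
      then have "x = w" if "(w, x) \<in> (kempe_rel C a b d)\<^sup>*" for x
        using that by (metis converse_rtranclE)
      then have "kempe_below C w a b d = {}"
        using none by (fastforce simp: kempe_below_def)
      then show ?thesis
        using False by (subst fix_forbidden.simps) (simp add: child_w recolor_on_def)
    next
      case True
      then obtain z where z: "(w, z) \<in> C" "d {w, z} = Some a" by blast
      have uniq: "y = z" if "(w, y) \<in> C" "d {w, y} = Some a" for y
        using siblings[OF rtrancl_refl that(1) z(1)] that(2) z(2) by metis
      have the: "(THE y. child E R w y \<and> d {w, y} = Some a) = z"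
      proof (rule the_equality)
        show "child E R w z \<and> d {w, z} = Some a" using z child_w by simp
        show "y = z" if "child E R w y \<and> d {w, y} = Some a" for y
          using that uniq[of y] child_w[of y] by simp
      qed
      define d' where "d' = d({w, z} \<mapsto> b)"
      \<comment> \<open>The only edge that was recolored is not below \<open>z\<close>, so all
        hypotheses pass from \<open>d\<close> to \<open>d'\<close> on the subtree of
        \<open>z\<close>.\<close>
      have d'_below: "d' {x, y} = d {x, y}" if "(z, x) \<in> C\<^sup>*" "(x, y) \<in> C" for x y
        using edge_below_neq[OF C z(1) that] by (simp add: d'_def)
      have desc: "(w, x) \<in> C\<^sup>*" if "(z, x) \<in> C\<^sup>*" for x
        using that z(1) by (rule converse_rtrancl_into_rtrancl[rotated])
      have "fix_forbidden E R w b a d = fix_forbidden E R z a b d'"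
      proof -
        have "\<not> (\<nexists>y. child E R w y \<and> d {w, y} = Some a)" using z child_w by blast
        then show ?thesis
          by (subst fix_forbidden.simps) (simp only: the d'_def Let_def if_False)
      qed
      also have "\<dots> = recolor_on (kempe_below C z b a d') b a d'"
      proof (rule less.IH)
        show "(z, w) \<in> C\<inverse>" using z(1) by simp
        show "child E R x y \<longleftrightarrow> (x, y) \<in> C" if "(z, x) \<in> C\<^sup>*" for x y
          using child desc[OF that] by blast
        \<comment> \<open>The invariant at \<open>z\<close>: the edge \<open>{w, z}\<close> had
          color \<open>a\<close>, so no edge directly below it does.\<close>
        show "d' {z, y} \<noteq> Some a" if "(z, y) \<in> C" for y
          using d'_below[OF _ that] down[OF rtrancl_refl z(1) that] z(2) by auto
        show "d' {x, y} \<noteq> d' {y, y'}" if "(z, x) \<in> C\<^sup>*" "(x, y) \<in> C" "(y, y') \<in> C" for x y y'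
          using d'_below[OF that(1,2)] d'_below[OF rtrancl_into_rtrancl[OF that(1,2)] that(3)]
            down[OF desc[OF that(1)] that(2,3)] by simp
        show "d' {x, y} \<noteq> d' {x, y'}"
          if "(z, x) \<in> C\<^sup>*" "(x, y) \<in> C" "(x, y') \<in> C" "y \<noteq> y'" for x y y'
          using d'_below[OF that(1,2)] d'_below[OF that(1,3)]
            siblings[OF desc[OF that(1)] that(2,3,4)] by simp
        show "b \<noteq> a" using \<open>a \<noteq> b\<close> by simp
      qed
      \<comment> \<open>Recoloring \<open>{w, z}\<close> from \<open>a\<close> to \<open>b\<close>
        stays within the two colors and therefore does not change the chain.\<close>
      also have "kempe_below C z b a d' = kempe_below C z a b d"
        unfolding kempe_below_commute[of C z b a]
        by (intro kempe_below_cong kempe_rel_cong) (use z(2) in \<open>auto simp: d'_def\<close>)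
      also have "recolor_on (kempe_below C z a b d) b a d' = recolor_on (kempe_below C w a b d) a b d"
      proof -
        \<comment> \<open>Exactly one arc of the chain leaves \<open>w\<close>, so the chain below
          \<open>w\<close> is \<open>{w, z}\<close> followed by the chain below
          \<open>z\<close>.\<close>
        have step: "(w, y) \<in> kempe_rel C a b d \<longleftrightarrow> y = z" for y
          using uniq[of y] no_b[of y] z unfolding kempe_rel_def by auto
        have reach: "(w, x) \<in> (kempe_rel C a b d)\<^sup>* \<longleftrightarrow> x = w \<or> (z, x) \<in> (kempe_rel C a b d)\<^sup>*" for x
        proof
          assume "(w, x) \<in> (kempe_rel C a b d)\<^sup>*"
          then show "x = w \<or> (z, x) \<in> (kempe_rel C a b d)\<^sup>*"
            by (cases rule: converse_rtranclE) (simp_all add: step)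
        next
          assume "x = w \<or> (z, x) \<in> (kempe_rel C a b d)\<^sup>*"
          moreover have "(w, z) \<in> kempe_rel C a b d" by (simp add: step)
          ultimately show "(w, x) \<in> (kempe_rel C a b d)\<^sup>*"
            by (blast intro: converse_rtrancl_into_rtrancl)
        qed
        have "e \<in> kempe_below C w a b d \<longleftrightarrow>
            (\<exists>y. e = {w, y} \<and> (w, y) \<in> kempe_rel C a b d) \<or> e \<in> kempe_below C z a b d" for e
          unfolding kempe_below_def mem_Collect_eq reach by blast
        then have "kempe_below C w a b d = insert {w, z} (kempe_below C z a b d)"
          unfolding step by auto
        then show ?thesis
          using kempe_below_nmem[OF C z(1)] z(2)
          by (auto simp: recolor_on_def d'_def fun_eq_iff Transposition.transpose_commute[of a b])
      qed
      finally show ?thesis .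
    qed
  qed
qed

section \<open>Proper edge colorings and the swap of one chain\<close>

lemma proper_coloringsD:
  assumes "c \<in> proper_colorings \<kappa> E"
  shows "e \<in> E \<Longrightarrow> \<exists>a \<in> {1..\<kappa>}. c e = Some a" and "e \<notin> E \<Longrightarrow> c e = None"
    and "e \<in> E \<Longrightarrow> f \<in> E \<Longrightarrow> e \<noteq> f \<Longrightarrow> e \<inter> f \<noteq> {} \<Longrightarrow> c e \<noteq> c f"
  using assms by (auto simp: proper_colorings_def dom_def ran_def)

lemma finite_proper_colorings:
  assumes "finite E"
  shows "finite (proper_colorings \<kappa> E)"
proof -
  have "proper_colorings \<kappa> E \<subseteq> {c. dom c = E \<and> ran c \<subseteq> {1..\<kappa>}}"
    by (auto simp: proper_colorings_def)
  then show ?thesis by (rule finite_subset) (simp add: assms finite_set_of_finite_maps)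
qed

text \<open>Any two edges at \<open>x\<close> meet, so a proper coloring is injective on them, with
  values in \<open>{1..\<kappa>}\<close>.\<close>

lemma card_available:
  assumes c: "c \<in> proper_colorings \<kappa> E" and E: "finite E"
  shows "card (available \<kappa> c x) = \<kappa> - degree E x"
proof -
  let ?S = "{e \<in> E. x \<in> e}"
  have used: "{a. \<exists>e. x \<in> e \<and> c e = Some a} = (\<lambda>e. the (c e)) ` ?S"
  proof (intro equalityI subsetI)
    fix a assume "a \<in> {a. \<exists>e. x \<in> e \<and> c e = Some a}"
    then obtain e where e: "x \<in> e" "c e = Some a" by blast
    then have "e \<in> E" using proper_coloringsD(2)[OF c, of e] by (cases "e \<in> E") auto
    then show "a \<in> (\<lambda>e. the (c e)) ` ?S" using e by (auto intro!: image_eqI[of _ _ e])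
  next
    fix a assume "a \<in> (\<lambda>e. the (c e)) ` ?S"
    then obtain e where e: "e \<in> E" "x \<in> e" "a = the (c e)" by blast
    then show "a \<in> {a. \<exists>e. x \<in> e \<and> c e = Some a}"
      using proper_coloringsD(1)[OF c e(1)] by auto
  qed
  have "inj_on (\<lambda>e. the (c e)) ?S"
  proof (rule inj_onI, rule ccontr)
    fix e f assume ef: "e \<in> ?S" "f \<in> ?S" "the (c e) = the (c f)" "e \<noteq> f"
    then have "e \<inter> f \<noteq> {}" by blast
    with ef show False
      using proper_coloringsD(3)[OF c, of e f] proper_coloringsD(1)[OF c, of e]
        proper_coloringsD(1)[OF c, of f] by auto
  qed
  then have "card ((\<lambda>e. the (c e)) ` ?S) = degree E x" by (simp add: card_image degree_def)
  moreover have "(\<lambda>e. the (c e)) ` ?S \<subseteq> {1..\<kappa>}"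
  proof
    fix a assume "a \<in> (\<lambda>e. the (c e)) ` ?S"
    then obtain e where "e \<in> E" "a = the (c e)" by blast
    then show "a \<in> {1..\<kappa>}" using proper_coloringsD(1)[OF c, of e] by auto
  qed
  ultimately show ?thesis
    using E unfolding available_def used by (subst card_Diff_subset) auto
qed

text \<open>Together with the restriction lemma below, this identifies the proper colorings of the
  joined forest with those of the split one paired with a color available at both ends.\<close>

lemma proper_colorings_extend:
  assumes "c \<in> proper_colorings \<kappa> E" and "{u, v} \<notin> E"
    and "b \<in> available \<kappa> c u" and "b \<in> available \<kappa> c v"
  shows "c({u, v} \<mapsto> b) \<in> proper_colorings \<kappa> (insert {u, v} E)"
proof -
  have "c e \<noteq> Some b" if "e \<inter> {u, v} \<noteq> {}" for e
    using assms(3,4) that by (auto simp: available_def)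
  then show ?thesis
    using assms unfolding proper_colorings_def available_def
    by (auto simp: ran_def Int_commute)
qed

lemma proper_colorings_restrict:
  assumes c: "c \<in> proper_colorings \<kappa> (insert {u, v} E)" and uv: "{u, v} \<notin> E"
  shows "c({u, v} := None) \<in> proper_colorings \<kappa> E"
    and "the (c {u, v}) \<in> available \<kappa> (c({u, v} := None)) u"
    and "the (c {u, v}) \<in> available \<kappa> (c({u, v} := None)) v"
proof -
  have "dom (c({u, v} := None)) = E" using c uv by (auto simp: proper_colorings_def)
  moreover have "ran (c({u, v} := None)) \<subseteq> {1..\<kappa>}"
    using c by (auto simp: proper_colorings_def ran_def)
  ultimately show "c({u, v} := None) \<in> proper_colorings \<kappa> E"
    using c uv by (auto simp: proper_colorings_def)
  obtain b where b: "b \<in> {1..\<kappa>}" "c {u, v} = Some b"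
    using proper_coloringsD(1)[OF c] by blast
  have "(c({u, v} := None)) e \<noteq> Some b" if "e \<inter> {u, v} \<noteq> {}" for e
  proof (cases "e = {u, v}")
    case False
    then show ?thesis
      using proper_coloringsD(2)[OF c, of e] proper_coloringsD(3)[OF c, of e "{u, v}"] b that
      by force
  qed simp
  then show "the (c {u, v}) \<in> available \<kappa> (c({u, v} := None)) u"
    "the (c {u, v}) \<in> available \<kappa> (c({u, v} := None)) v"
    using b unfolding available_def by fastforce+
qed

text \<open>Common setting of both updates, where \<open>c\<close> colors the forest without the
  updated edge. For an insertion \<open>b\<close> is the color of the new edge and \<open>a\<close>
  the one drawn at \<open>v\<close>; for a deletion \<open>a\<close> is the color of the removed
  edge and \<open>b\<close> that of the chosen child edge.\<close>

locale kempe_swap =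
  fixes C :: "'v rel" and \<kappa> :: nat and c :: "'v coloring" and v w :: 'v and a b :: nat
  assumes C: "arborescence C" and root: "v \<notin> Range C" and vw: "(v, w) \<in> C"
    and c: "c \<in> proper_colorings \<kappa> (edges C)"
    and b: "c {v, w} = Some b" and a: "a \<in> available \<kappa> c v"
begin

lemma a_unused: "v \<in> e \<Longrightarrow> c e \<noteq> Some a"
  using a by (auto simp: available_def)

lemma a_neq_b: "a \<noteq> b"
  using a_unused[of "{v, w}"] b by auto

lemma kempe_vw: "kempe C v w a b c {v, w} = Some a"
  by (simp add: kempe_def recolor_on_def b)

lemma below_component:
  assumes "e \<in> kempe_below C w a b c"
  shows "e \<subseteq> component (edges C) v"
proof -
  obtain x y where e: "e = {x, y}" "(w, x) \<in> (kempe_rel C a b c)\<^sup>*" "(x, y) \<in> kempe_rel C a b c"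
    using assms by (auto simp: kempe_below_def)
  then have "(v, x) \<in> C\<^sup>*" "(x, y) \<in> C"
    using kempe_rel_rtranclD[OF e(2)] kempe_rel_subset[of C a b c] vw
    by (auto intro: converse_rtrancl_into_rtrancl)
  then show ?thesis
    using descendant_component[of v x C] descendant_component[of v y C] e(1)
    by (auto intro: rtrancl_into_rtrancl)
qed

lemma below_avoids_root:
  assumes "e \<in> kempe_below C w a b c"
  shows "v \<notin> e"
proof -
  obtain x y where e: "e = {x, y}" "(w, x) \<in> (kempe_rel C a b c)\<^sup>*" "(x, y) \<in> kempe_rel C a b c"
    using assms by (auto simp: kempe_below_def)
  then have "(w, x) \<in> C\<^sup>*" "(x, y) \<in> C"
    using kempe_rel_rtranclD[OF e(2)] kempe_rel_subset[of C a b c] by auto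
  then show ?thesis
    using arborescence_no_cycle[OF C vw] root e(1) by auto
qed

text \<open>The chain stays inside the tree of \<open>v\<close>, hence the colors seen at the other
  end of the updated edge are preserved.\<close>

lemma kempe_outside:
  assumes "u \<notin> component (edges C) v" "u \<in> e"
  shows "kempe C v w a b c e = c e"
proof -
  have "w \<in> component (edges C) v" using vw by (intro descendant_component) auto
  then have "e \<notin> insert {v, w} (kempe_below C w a b c)"
    using below_component assms component_refl by fastforce
  then show ?thesis by (simp add: kempe_def recolor_on_def)
qed

lemma kempe_at_root:
  assumes "v \<in> e" "e \<noteq> {v, w}"
  shows "kempe C v w a b c e = c e"
  using below_avoids_root assms by (auto simp: kempe_def recolor_on_def)

lemma chain_closed:
  assumes e: "e \<in> insert {v, w} (kempe_below C w a b c)"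
    and f: "f \<in> edges C" "c f \<in> {Some a, Some b}" and ef: "e \<inter> f \<noteq> {}"
  shows "f \<in> insert {v, w} (kempe_below C w a b c)"
proof -
  let ?D = "kempe_rel C a b c"
  obtain p q where pq: "f = {p, q}" "(p, q) \<in> C" using f(1) by (rule edges_cases)
  then have pqD: "(p, q) \<in> ?D" using f(2) by (auto simp: kempe_rel_def)
  have mem: "f \<in> kempe_below C w a b c" if "(w, p) \<in> ?D\<^sup>*"
    using that pqD pq(1) by (auto simp: kempe_below_def)
  have up: "f = {v, w} \<or> (w, p) \<in> ?D\<^sup>*" if "(w, q) \<in> ?D\<^sup>*"
    using that
  proof (cases rule: rtranclE)
    case base
    then show ?thesis using pq arborescence_parent[OF C vw, of p] by auto
  next
    case (step p')
    then show ?thesis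
      using arborescence_parent[OF C pq(2), of p'] kempe_rel_subset by blast
  qed
  have at_root: "f = {v, w}" if "v \<in> f"
  proof (rule ccontr)
    assume "f \<noteq> {v, w}"
    moreover have "{v, w} \<in> edges C" using vw by (simp add: edges_iff)
    ultimately have "c f \<noteq> c {v, w}" using proper_coloringsD(3)[OF c f(1)] that by auto
    then show False using f(2) b a_unused[OF that] by auto
  qed
  obtain z where z: "z \<in> e" "z \<in> f" using ef by blast
  have "z = v \<or> (w, z) \<in> ?D\<^sup>*"
    using e z(1) by (auto simp: kempe_below_def intro: rtrancl_into_rtrancl)
  then show ?thesis
    using at_root z(2) mem up pq(1) by auto
qed

lemma chain_color:
  assumes "e \<in> insert {v, w} (kempe_below C w a b c)"
  shows "c e \<in> {Some a, Some b}"
  using assms b by (auto simp: kempe_below_def kempe_rel_def)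

text \<open>The transposition is injective, so only a pair with one edge in the chain could clash.
  The edge of the chain keeps a color among \<open>a\<close> and \<open>b\<close>, while
  \<open>chain_closed\<close> excludes both colors for the adjacent edge outside.\<close>

lemma kempe_proper: "kempe C v w a b c \<in> proper_colorings \<kappa> (edges C)"
proof -
  let ?S = "insert {v, w} (kempe_below C w a b c)"
  let ?K = "kempe C v w a b c"
  have inS: "?K e = map_option (Transposition.transpose a b) (c e)" if "e \<in> ?S" for e
    using that by (simp add: kempe_def recolor_on_def)
  have notinS: "?K e = c e" if "e \<notin> ?S" for e
    using that by (simp add: kempe_def recolor_on_def)
  have swap: "map_option (Transposition.transpose a b) (c e) \<in> {Some a, Some b}" if "e \<in> ?S" for e
    using chain_color[OF that] by auto
  have ab: "a \<in> {1..\<kappa>}" "b \<in> {1..\<kappa>}"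
    using a b c by (auto simp: available_def proper_colorings_def ran_def)
  have "?K e = None \<longleftrightarrow> c e = None" for e by (cases "e \<in> ?S") (simp_all add: inS notinS)
  then have "dom ?K = edges C" using c by (auto simp: proper_colorings_def dom_def)
  moreover have "ran ?K \<subseteq> {1..\<kappa>}"
  proof
    fix y assume "y \<in> ran ?K"
    then obtain e where e: "?K e = Some y" by (auto simp: ran_def)
    show "y \<in> {1..\<kappa>}"
    proof (cases "e \<in> ?S")
      case True
      then show ?thesis using e swap[OF True] ab by (auto simp: inS)
    next
      case False
      then show ?thesis using e c by (auto simp: notinS proper_colorings_def ran_def)
    qed
  qed
  moreover have "?K e \<noteq> ?K f"
    if e: "e \<in> edges C" and f: "f \<in> edges C" and ef: "e \<noteq> f" "e \<inter> f \<noteq> {}" for e f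
  proof -
    have neq: "c e \<noteq> c f" using proper_coloringsD(3)[OF c e f ef] .
    consider "e \<in> ?S" "f \<in> ?S" | "e \<notin> ?S" "f \<notin> ?S" | "e \<in> ?S" "f \<notin> ?S" | "e \<notin> ?S" "f \<in> ?S"
      by blast
    then show ?thesis
    proof cases
      case 1
      then show ?thesis
        using neq option.inj_map[OF Transposition.inj_transpose, of a b] by (simp add: inS inj_eq)
    next
      case 2
      then show ?thesis using neq by (simp add: notinS)
    next
      case 3
      then have "c f \<notin> {Some a, Some b}" using chain_closed f ef by blast
      then show ?thesis using 3 swap[OF 3(1)] by (auto simp: inS notinS)
    next
      case 4
      then have "c e \<notin> {Some a, Some b}" using chain_closed e ef by blast
      then show ?thesis using 4 swap[OF 4(2)] by (auto simp: inS notinS)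
    qed
  qed
  ultimately show ?thesis by (auto simp: proper_colorings_def)
qed

text \<open>At \<open>v\<close> only \<open>{v, w}\<close> had color \<open>b\<close>, and it now
  has \<open>a\<close>. Thus the swap exchanges the roles of the two colors at \<open>v\<close>,
  which is what makes the move reversible.\<close>

lemma b_available:
  "b \<in> available \<kappa> (kempe C v w a b c) v"
proof -
  have "kempe C v w a b c e \<noteq> Some b" if "v \<in> e" for e
  proof (cases "e = {v, w}")
    case True
    then show ?thesis using kempe_vw a_neq_b by simp
  next
    case False
    have "c e \<noteq> Some b"
    proof
      assume *: "c e = Some b"
      then have "e \<in> edges C" using proper_coloringsD(2)[OF c, of e] by force
      moreover have "{v, w} \<in> edges C" using vw by (simp add: edges_iff)
      ultimately show False using proper_coloringsD(3)[OF c _ _ False] that * b by auto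
    qed
    then show ?thesis using kempe_at_root[OF that False] by simp
  qed
  moreover have "b \<in> {1..\<kappa>}" using b c by (auto simp: proper_colorings_def ran_def)
  ultimately show ?thesis by (auto simp: available_def)
qed

text \<open>The coloring \<open>d\<close> is the intermediate one, with the top edge already
  recolored; it may also color edges outside \<open>C\<close>, such as the newly inserted one, and
  these are left alone.\<close>

lemma fix_forbidden_eq_kempe:
  assumes ch: "\<And>x y. (w, x) \<in> C\<^sup>* \<Longrightarrow> child E R x y \<longleftrightarrow> (x, y) \<in> C"
    and d: "\<And>e. e \<in> edges C \<Longrightarrow> e \<noteq> {v, w} \<Longrightarrow> d e = c e" and dvw: "d {v, w} = Some a"
  shows "fix_forbidden E R w b a d e = (if e \<in> edges C then kempe C v w a b c e else d e)"
proof -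
  have d_below: "d {x, y} = c {x, y}" if "(w, x) \<in> C\<^sup>*" "(x, y) \<in> C" for x y
    using d edge_below_neq[OF C vw that] that(2) by (simp add: edges_iff)
  have *: "fix_forbidden E R w b a d = recolor_on (kempe_below C w a b d) a b d"
  proof (rule fix_forbidden_eq_recolor[OF C ch])
    show "d {w, z} \<noteq> Some b" if "(w, z) \<in> C" for z
    proof -
      have "{w, z} \<noteq> {v, w}" using edge_below_neq[OF C vw _ that] by simp
      then have "c {w, z} \<noteq> c {v, w}"
        using proper_coloringsD(3)[OF c, of "{w, z}" "{v, w}"] that vw by (auto simp: edges_iff)
      then show ?thesis using d_below[OF _ that] b by auto
    qed
    show "d {x, y} \<noteq> d {y, z}" if "(w, x) \<in> C\<^sup>*" "(x, y) \<in> C" "(y, z) \<in> C" for x y z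
      using proper_coloringsD(3)[OF c, of "{x, y}" "{y, z}"] edge_below_neq[OF C that(2) _ that(3)]
        d_below[OF that(1,2)] d_below[OF rtrancl_into_rtrancl[OF that(1,2)] that(3)] that
      by (auto simp: edges_iff)
    show "d {x, y} \<noteq> d {x, z}" if "(w, x) \<in> C\<^sup>*" "(x, y) \<in> C" "(x, z) \<in> C" "y \<noteq> z" for x y z
      using proper_coloringsD(3)[OF c, of "{x, y}" "{x, z}"] d_below[OF that(1,2)]
        d_below[OF that(1,3)] that by (auto simp: edges_iff doubleton_eq_iff)
  qed (use a_neq_b in auto)
  have below: "kempe_below C w a b d = kempe_below C w a b c"
  proof (intro kempe_below_cong kempe_rel_cong)
    fix x y assume "(x, y) \<in> C"
    then have "{x, y} \<in> edges C" by (simp add: edges_iff)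
    then show "d {x, y} \<in> {Some a, Some b} \<longleftrightarrow> c {x, y} \<in> {Some a, Some b}"
      using d[of "{x, y}"] dvw b by (cases "{x, y} = {v, w}") auto
  qed
  have sub: "kempe_below C w a b c \<subseteq> edges C"
    using kempe_rel_subset[of C a b c] by (auto simp: kempe_below_def edges_iff)
  show ?thesis
    using sub kempe_below_nmem[OF C vw, of a b c] d[of e] dvw b
    unfolding * below kempe_def recolor_on_def
    by (cases "e = {v, w}") (auto simp: edges_iff vw)
qed

end

section \<open>Reversibility of insertion and deletion\<close>

text \<open>Sum the balance equation over \<open>P\<close>: since \<open>g y\<close> has total mass
  1 there, every \<open>y\<close> in \<open>Q\<close> receives the same mass. The weights
  \<open>r\<close> and \<open>s\<close> are kept symmetric, so that one balance equation serves both
  directions.\<close>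

lemma uniform_of_detailed_balance:
  fixes r s :: real
  assumes P: "finite P" "P \<noteq> {}" and Q: "finite Q"
    and f: "\<And>x. x \<in> P \<Longrightarrow> set_pmf (f x) \<subseteq> Q" and g: "\<And>y. y \<in> Q \<Longrightarrow> set_pmf (g y) \<subseteq> P"
    and balance: "\<And>x y. x \<in> P \<Longrightarrow> y \<in> Q \<Longrightarrow> pmf (f x) y * r = pmf (g y) x * s"
    and r: "r > 0"
  shows "Q \<noteq> {}" and "bind_pmf (pmf_of_set P) f = pmf_of_set Q"
proof -
  show nonempty: "Q \<noteq> {}"
    using P f set_pmf_not_empty by (metis all_not_in_conv subset_empty)
  let ?M = "bind_pmf (pmf_of_set P) f"
  \<comment> \<open>The common mass; that it equals \<open>1 / card Q\<close> follows from the total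
    mass being 1.\<close>
  define K where "K = s / r / card P"
  have supp: "set_pmf ?M \<subseteq> Q" using f P by auto
  have K: "pmf ?M y = K" if y: "y \<in> Q" for y
  proof -
    have "pmf (f x) y = pmf (g y) x * (s / r)" if "x \<in> P" for x
      using balance[OF that y] r by (simp add: field_simps)
    then have "(\<Sum>x\<in>P. pmf (f x) y) = (\<Sum>x\<in>P. pmf (g y) x * (s / r))"
      by (rule sum.cong[OF refl])
    also have "\<dots> = (\<Sum>x\<in>P. pmf (g y) x) * (s / r)"
      by (rule sum_distrib_right[symmetric])
    also have "(\<Sum>x\<in>P. pmf (g y) x) = 1" by (rule sum_pmf_eq_1[OF P(1) g[OF y]])
    finally show ?thesis using P by (simp add: pmf_bind_pmf_of_set K_def)
  qed
  have "1 = (\<Sum>y\<in>Q. pmf ?M y)" using sum_pmf_eq_1[OF Q supp] by simp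
  then have "card Q * K = 1" using K by simp
  then have "K = 1 / card Q" using nonempty Q by (simp add: field_simps)
  moreover have "pmf ?M y = 0" if "y \<notin> Q" for y
    using supp that pmf_eq_0_set_pmf by fastforce
  ultimately show "?M = pmf_of_set Q"
    using K Q nonempty by (intro pmf_eqI) (auto simp: indicator_def)
qed

lemma pmf_map_pmf_of_set:
  assumes "finite A" "A \<noteq> {}"
  shows "pmf (map_pmf f (pmf_of_set A)) y = (\<Sum>x\<in>A. indicat_real {y} (f x)) / card A"
  using assms by (simp add: map_pmf_def pmf_bind_pmf_of_set)

lemma pmf_bernoulli_bind:
  assumes "0 \<le> p" "p \<le> 1"
  shows "pmf (bind_pmf (bernoulli_pmf p) f) y = p * pmf (f True) y + (1 - p) * pmf (f False) y"
  using assms by (simp add: pmf_bind)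

section \<open>The insertion and deletion kernels for one edge\<close>

lemma degree_insert_edge:
  assumes "finite E" "{u, v} \<notin> E" "x \<in> {u, v}"
  shows "degree (insert {u, v} E) x = Suc (degree E x)"
proof -
  have "{e \<in> insert {u, v} E. x \<in> e} = insert {u, v} {e \<in> E. x \<in> e}" using assms(3) by auto
  then show ?thesis using assms by (simp add: degree_def)
qed

lemma degree_mono: "finite F \<Longrightarrow> E \<subseteq> F \<Longrightarrow> degree E x \<le> degree F x"
  unfolding degree_def by (intro card_mono) auto

text \<open>Here \<open>C\<close> is the forest without the edge \<open>{u, v}\<close>, rooted so
  that \<open>v\<close> is the root of its tree. The strict degree bounds guarantee an available
  color at each end.\<close>

locale attach =
  fixes C :: "'v rel" and u v :: 'v and \<kappa> :: nat
  assumes C: "arborescence C" and root: "v \<notin> Range C" and u: "u \<notin> component (edges C) v"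
    and deg_u: "degree (edges C) u < \<kappa>" and deg_v: "degree (edges C) v < \<kappa>"
begin

abbreviation "P0 \<equiv> proper_colorings \<kappa> (edges C)"
abbreviation "P1 \<equiv> proper_colorings \<kappa> (insert {u, v} (edges C))"
abbreviation "children \<equiv> {w. (v, w) \<in> C}"

text \<open>The effect of an insertion on the coloring once \<open>b\<close> is drawn at
  \<open>u\<close>, with the recursive repair expressed as a Kempe swap in the forest without the
  new edge.\<close>

definition insert_color :: "'v coloring \<Rightarrow> nat \<Rightarrow> 'v coloring pmf" where
  "insert_color c b =
     (if \<nexists>w. (v, w) \<in> C \<and> c {v, w} = Some b then return_pmf (c({u, v} \<mapsto> b))
      else let w = (THE w. (v, w) \<in> C \<and> c {v, w} = Some b)
           in map_pmf (\<lambda>a. (kempe C v w a b c)({u, v} \<mapsto> b)) (pmf_of_set (available \<kappa> c v)))"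

definition insert_kernel :: "'v coloring \<Rightarrow> 'v coloring pmf" where
  "insert_kernel c = bind_pmf (pmf_of_set (available \<kappa> c u)) (insert_color c)"

text \<open>If \<open>v\<close> has no child, the stopping probability is 1, so the unspecified
  \<open>pmf_of_set {}\<close> never contributes.\<close>

definition delete_kernel :: "'v coloring \<Rightarrow> 'v coloring pmf" where
  "delete_kernel d =
     (let a = the (d {u, v}); c = d({u, v} := None); l = card children
      in bind_pmf (bernoulli_pmf ((real \<kappa> - real l) / real \<kappa>))
           (\<lambda>stop. if stop then return_pmf c
             else map_pmf (\<lambda>w. kempe C v w a (the (c {v, w})) c) (pmf_of_set children)))"

lemma u_neq_v: "u \<noteq> v"
  using u component_refl by metis

lemma uv_new: "{u, v} \<notin> edges C"
proof
  assume "{u, v} \<in> edges C"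
  then have "component (edges C) u = component (edges C) v" by (rule component_eqI)
  then show False using u component_refl by metis
qed

lemma edge_at_root:
  assumes "e \<in> edges C" "v \<in> e"
  obtains w where "e = {v, w}" "(v, w) \<in> C"
proof -
  obtain x y where "e = {x, y}" "(x, y) \<in> C" using assms(1) by (rule edges_cases)
  then show thesis using assms(2) root that by auto
qed

lemma finite_children: "finite children"
proof -
  have "children \<subseteq> Range C" by auto
  then show ?thesis using C by (meson arborescence_def finite_Range finite_subset)
qed

text \<open>All edges at the root \<open>v\<close> lead to children. Hence \<open>\<kappa>\<close>
  minus the number of children, the numerator of the stopping probability, also counts the colors
  available at \<open>v\<close>.\<close>

lemma card_children: "card children = degree (edges C) v"
proof -
  have "{e \<in> edges C. v \<in> e} = (\<lambda>w. {v, w}) ` children"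
    using edge_at_root by (auto simp: edges_iff)
  moreover have "inj_on (\<lambda>w. {v, w}) children" by (auto simp: inj_on_def doubleton_eq_iff)
  ultimately show ?thesis by (simp add: degree_def card_image)
qed

lemma finite_available: "finite (available \<kappa> c x)"
  by (simp add: available_def)

lemma card_available_u: "c \<in> P0 \<Longrightarrow> card (available \<kappa> c u) = \<kappa> - degree (edges C) u"
  and card_available_v: "c \<in> P0 \<Longrightarrow> card (available \<kappa> c v) = \<kappa> - card children"
  by (simp_all add: card_available finite_edges[OF C] card_children)

lemma available_nonempty:
  assumes "c \<in> P0"
  shows "available \<kappa> c u \<noteq> {}" "available \<kappa> c v \<noteq> {}"
proof -
  have "card (available \<kappa> c u) \<noteq> 0" "card (available \<kappa> c v) \<noteq> 0"
    using deg_u deg_v by (simp_all add: card_available_u card_available_v assms card_children)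
  then show "available \<kappa> c u \<noteq> {}" "available \<kappa> c v \<noteq> {}" by auto
qed

lemma set_pmf_available:
  assumes "c \<in> P0"
  shows "set_pmf (pmf_of_set (available \<kappa> c u)) = available \<kappa> c u"
    and "set_pmf (pmf_of_set (available \<kappa> c v)) = available \<kappa> c v"
  by (simp_all add: available_nonempty[OF assms] finite_available)

lemma uncolored_uv: "c \<in> P0 \<Longrightarrow> c {u, v} = None"
  using uv_new proper_coloringsD(2) by metis

lemma swapI:
  assumes "c \<in> P0" "(v, w) \<in> C" "c {v, w} = Some b" "a \<in> available \<kappa> c v"
  shows "kempe_swap C \<kappa> c v w a b"
  using assms C root by unfold_locales

lemma child_unique:
  assumes c: "c \<in> P0" and "(v, w) \<in> C" "c {v, w} = Some b" "(v, w') \<in> C" "c {v, w'} = Some b"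
  shows "w' = w"
proof (rule ccontr)
  assume "w' \<noteq> w"
  then have "{v, w} \<noteq> {v, w'}" by (auto simp: doubleton_eq_iff)
  then have "c {v, w} \<noteq> c {v, w'}"
    using assms(2,4) by (intro proper_coloringsD(3)[OF c]) (auto simp: edges_iff)
  then show False using assms(3,5) by simp
qed

lemma the_child:
  assumes "c \<in> P0" "(v, w) \<in> C" "c {v, w} = Some b"
  shows "(THE w. (v, w) \<in> C \<and> c {v, w} = Some b) = w"
  by (rule the_equality) (use assms(2,3) child_unique[OF assms] in blast)+

lemma available_v:
  assumes c: "c \<in> P0" and b: "b \<in> {1..\<kappa>}" and none: "\<nexists>w. (v, w) \<in> C \<and> c {v, w} = Some b"
  shows "b \<in> available \<kappa> c v"
proof -
  have "c e \<noteq> Some b" if "v \<in> e" for e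
  proof (cases "e \<in> edges C")
    case True
    then show ?thesis using none that by (metis edge_at_root)
  next
    case False
    then show ?thesis using proper_coloringsD(2)[OF c] by simp
  qed
  then show ?thesis using b by (auto simp: available_def)
qed

lemma kempe_available_u:
  assumes "kempe_swap C \<kappa> c v w a b"
  shows "available \<kappa> (kempe C v w a b c) u = available \<kappa> c u"
  using kempe_swap.kempe_outside[OF assms u] unfolding available_def by metis

lemma insert_color_stop:
  "\<nexists>w. (v, w) \<in> C \<and> c {v, w} = Some b \<Longrightarrow> insert_color c b = return_pmf (c({u, v} \<mapsto> b))"
  by (simp add: insert_color_def)

lemma insert_color_flip:
  assumes "c \<in> P0" "(v, w) \<in> C" "c {v, w} = Some b"
  shows "insert_color c b =
    map_pmf (\<lambda>a. (kempe C v w a b c)({u, v} \<mapsto> b)) (pmf_of_set (available \<kappa> c v))"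
proof -
  have "\<not> (\<nexists>w. (v, w) \<in> C \<and> c {v, w} = Some b)" using assms by blast
  then show ?thesis by (simp only: insert_color_def if_False Let_def the_child[OF assms])
qed

text \<open>If no child edge of \<open>v\<close> has the drawn color \<open>b\<close>, then
  \<open>b\<close> is free at both ends. Otherwise the swap frees \<open>b\<close> at
  \<open>v\<close> and does not touch the colors at \<open>u\<close>.\<close>

lemma insert_kernel_support:
  assumes c: "c \<in> P0"
  shows "set_pmf (insert_kernel c) \<subseteq> P1"
proof
  fix d assume "d \<in> set_pmf (insert_kernel c)"
  then obtain b where bu: "b \<in> available \<kappa> c u" and d: "d \<in> set_pmf (insert_color c b)"
    by (auto simp: insert_kernel_def set_pmf_available[OF c])
  have b': "b \<in> {1..\<kappa>}" using bu by (simp add: available_def)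
  show "d \<in> P1"
  proof (cases "\<exists>w. (v, w) \<in> C \<and> c {v, w} = Some b")
    case False
    then have "d = c({u, v} \<mapsto> b)" using d by (simp add: insert_color_stop)
    then show ?thesis
      using proper_colorings_extend[OF c uv_new bu available_v[OF c b' False]] by simp
  next
    case True
    then obtain w where w: "(v, w) \<in> C" "c {v, w} = Some b" by blast
    then obtain a where av: "a \<in> available \<kappa> c v" and d_eq: "d = (kempe C v w a b c)({u, v} \<mapsto> b)"
      using d by (auto simp: insert_color_flip[OF c w] set_pmf_available[OF c])
    interpret kempe_swap C \<kappa> c v w a b by (rule swapI[OF c w av])
    show ?thesis
      unfolding d_eq using kempe_available_u[OF kempe_swap_axioms] bu
      by (intro proper_colorings_extend kempe_proper uv_new b_available) simp
  qed
qed

lemma stop_probability: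
  shows "0 \<le> (real \<kappa> - real (card children)) / real \<kappa>"
    and "(real \<kappa> - real (card children)) / real \<kappa> \<le> 1"
    and "1 - (real \<kappa> - real (card children)) / real \<kappa> = card children / real \<kappa>"
  using deg_v by (auto simp: card_children field_simps)

lemma swap_restrictedI:
  assumes d: "d \<in> P1" and w: "(v, w) \<in> C"
  shows "kempe_swap C \<kappa> (d({u, v} := None)) v w (the (d {u, v})) (the ((d({u, v} := None)) {v, w}))"
proof (rule swapI[OF _ w])
  note restrict = proper_colorings_restrict[OF d uv_new]
  show "d({u, v} := None) \<in> P0" "the (d {u, v}) \<in> available \<kappa> (d({u, v} := None)) v"
    by (fact restrict)+
  have "{v, w} \<in> edges C" using w by (simp add: edges_iff)
  then show "(d({u, v} := None)) {v, w} = Some (the ((d({u, v} := None)) {v, w}))"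
    using proper_coloringsD(1)[OF restrict(1), of "{v, w}"] by (metis option.sel)
qed

lemma delete_kernel_support:
  assumes d: "d \<in> P1"
  shows "set_pmf (delete_kernel d) \<subseteq> P0"
proof
  let ?p = "(real \<kappa> - real (card children)) / real \<kappa>"
  let ?c = "d({u, v} := None)"
  fix c assume "c \<in> set_pmf (delete_kernel d)"
  then obtain stop where stop: "stop \<in> set_pmf (bernoulli_pmf ?p)"
    and c: "c \<in> set_pmf (if stop then return_pmf ?c
      else map_pmf (\<lambda>w. kempe C v w (the (d {u, v})) (the (?c {v, w})) ?c) (pmf_of_set children))"
    unfolding delete_kernel_def Let_def by auto
  show "c \<in> P0"
  proof (cases stop)
    case True
    then show ?thesis using c proper_colorings_restrict(1)[OF d uv_new] by simp
  next
    case False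
    \<comment> \<open>Not stopping has probability proportional to the number of children, so a
      child is drawn only from a nonempty set.\<close>
    then have "1 - ?p \<noteq> 0"
      using stop pmf_bernoulli_False[OF stop_probability(1,2)] by (simp add: set_pmf_iff)
    then have "children \<noteq> {}" unfolding stop_probability(3) by (metis card.empty div_0 of_nat_0)
    then obtain w where w: "(v, w) \<in> C"
      and "c = kempe C v w (the (d {u, v})) (the (?c {v, w})) ?c"
      using c False finite_children by auto
    then show ?thesis using kempe_swap.kempe_proper[OF swap_restrictedI[OF d w]] by simp
  qed
qed

text \<open>The probability of not stopping cancels the uniform choice of the child: each child is
  used with probability \<open>1 / \<kappa>\<close>.\<close>

lemma pmf_delete_kernel:
  fixes d :: "'v coloring"
  defines "c0 \<equiv> d({u, v} := None)"
  shows "pmf (delete_kernel d) c * real \<kappa> = real (\<kappa> - card children) * indicat_real {c} c0 +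
    (\<Sum>w\<in>children. indicat_real {c} (kempe C v w (the (d {u, v})) (the (c0 {v, w})) c0))"
proof -
  let ?S = "\<Sum>w\<in>children. indicat_real {c} (kempe C v w (the (d {u, v})) (the (c0 {v, w})) c0) :: real"
  let ?p = "(real \<kappa> - real (card children)) / real \<kappa>"
  let ?flip = "map_pmf (\<lambda>w. kempe C v w (the (d {u, v})) (the (c0 {v, w})) c0) (pmf_of_set children)"
  have "real (card children) * pmf ?flip c = ?S"
  proof (cases "children = {}")
    case True
    then show ?thesis by (simp only: card.empty sum.empty of_nat_0 mult_zero_left)
  next
    case False
    then show ?thesis using finite_children by (simp add: pmf_map_pmf_of_set)
  qed
  moreover have "pmf (delete_kernel d) c = ?p * indicat_real {c} c0 + (1 - ?p) * pmf ?flip c"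
    unfolding delete_kernel_def Let_def c0_def
    by (subst pmf_bernoulli_bind[OF stop_probability(1,2)]) simp
  moreover have "real \<kappa> > 0" "real (\<kappa> - card children) = real \<kappa> - real (card children)"
    using deg_v by (simp_all add: card_children)
  ultimately show ?thesis
    unfolding stop_probability(3) by (simp add: distrib_right)
qed

text \<open>The drawn color can be read off from the result at \<open>{u, v}\<close>, so a single
  draw contributes.\<close>

lemma pmf_insert_kernel:
  assumes c: "c \<in> P0" and d: "d {u, v} = Some b"
  shows "pmf (insert_kernel c) d * real (\<kappa> - degree (edges C) u) =
    (if b \<in> available \<kappa> c u then pmf (insert_color c b) d else 0)"
proof -
  have zero: "pmf (insert_color c b') d = 0" if "b' \<noteq> b" for b'
  proof -
    have "x {u, v} = Some b'" if "x \<in> set_pmf (insert_color c b')" for x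
      using that by (auto simp: insert_color_def Let_def split: if_splits)
    then have "d \<notin> set_pmf (insert_color c b')" using d that by fastforce
    then show ?thesis by (simp add: pmf_eq_0_set_pmf)
  qed
  have "(\<Sum>b'\<in>available \<kappa> c u. pmf (insert_color c b') d) =
      (\<Sum>b'\<in>available \<kappa> c u. if b' = b then pmf (insert_color c b) d else 0)"
    by (intro sum.cong) (auto simp: zero)
  also have "\<dots> = (if b \<in> available \<kappa> c u then pmf (insert_color c b) d else 0)"
    by (simp add: finite_available)
  finally show ?thesis
    using deg_u
    by (simp add: insert_kernel_def pmf_bind_pmf_of_set card_available_u[OF c]
        available_nonempty[OF c] finite_available)
qed

text \<open>The equivalence of the two swaps is the involution. The availability conditions come for
  free from the right: \<open>b\<close> is free at \<open>u\<close> in \<open>c0\<close>, where the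
  swap changes nothing, and the swap frees \<open>a\<close> at \<open>v\<close>.\<close>

lemma kempe_reverse:
  assumes c: "c \<in> P0" and d: "d \<in> P1" and w: "(v, w) \<in> C" "c {v, w} = Some b"
    and duv: "d {u, v} = Some b"
  defines "c0 \<equiv> d({u, v} := None)"
  defines "a \<equiv> the (c0 {v, w})"
  shows "b \<in> available \<kappa> c u \<and> a \<in> available \<kappa> c v \<and> kempe C v w a b c = c0 \<longleftrightarrow>
    kempe C v w b a c0 = c"
proof
  assume "b \<in> available \<kappa> c u \<and> a \<in> available \<kappa> c v \<and> kempe C v w a b c = c0"
  then show "kempe C v w b a c0 = c" by (metis kempe_commute kempe_involution)
next
  assume *: "kempe C v w b a c0 = c"
  interpret kempe_swap C \<kappa> c0 v w b a
    using swap_restrictedI[OF d w(1)] by (simp only: duv c0_def a_def option.sel)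
  have "b \<in> available \<kappa> c u"
    using kempe_available_u[OF kempe_swap_axioms] proper_colorings_restrict(2)[OF d uv_new] * duv
    by (simp add: c0_def)
  moreover have "a \<in> available \<kappa> c v" using b_available * by simp
  moreover have "kempe C v w a b c = c0" using * by (metis kempe_commute kempe_involution)
  ultimately show "b \<in> available \<kappa> c u \<and> a \<in> available \<kappa> c v \<and> kempe C v w a b c = c0" by simp
qed

text \<open>The color \<open>b\<close> of \<open>{u, v}\<close> in \<open>d\<close> decides the
  case. If no child edge has color \<open>b\<close> in \<open>c\<close>, both sides are
  \<open>\<kappa> - card children\<close> times the indicator of \<open>c = c0\<close>. Otherwise
  both sides are the indicator that the swap at the unique such child relates \<open>c\<close> and
  \<open>c0\<close>.\<close>

lemma detailed_balance:
  assumes c: "c \<in> P0" and d: "d \<in> P1"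
  shows "pmf (insert_kernel c) d * real ((\<kappa> - degree (edges C) u) * (\<kappa> - card children)) =
    pmf (delete_kernel d) c * real \<kappa>"
proof -
  define c0 where "c0 = d({u, v} := None)"
  obtain b where b: "d {u, v} = Some b" using proper_coloringsD(1)[OF d] by blast
  have d_eq: "d = c0({u, v} \<mapsto> b)" by (auto simp: c0_def b)
  have c0: "c0 \<in> P0" "b \<in> available \<kappa> c0 u" "b \<in> available \<kappa> c0 v"
    using proper_colorings_restrict[OF d uv_new] by (simp_all add: c0_def b)
  have upd_iff: "x({u, v} \<mapsto> b) = d \<longleftrightarrow> x = c0" if "x \<in> P0" for x
  proof
    assume upd: "x({u, v} \<mapsto> b) = d"
    show "x = c0"
    proof
      fix e
      show "x e = c0 e"
        using fun_cong[OF upd, of e] uncolored_uv[OF that] by (simp add: c0_def split: if_splits)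
    qed
  qed (simp add: d_eq)
  have ins: "pmf (insert_kernel c) d * real ((\<kappa> - degree (edges C) u) * (\<kappa> - card children)) =
      (if b \<in> available \<kappa> c u then pmf (insert_color c b) d * real (\<kappa> - card children) else 0)"
    unfolding of_nat_mult mult.assoc[symmetric] pmf_insert_kernel[OF c, of d b, OF b] by simp
  have del: "pmf (delete_kernel d) c * real \<kappa> = real (\<kappa> - card children) * indicat_real {c} c0 +
      (\<Sum>w\<in>children. indicat_real {c} (kempe C v w b (the (c0 {v, w})) c0))"
    using pmf_delete_kernel[of d c] by (simp add: c0_def b)
  \<comment> \<open>A deletion that swaps moves the color of the removed edge to the chosen child
    edge, so \<open>c\<close> reveals the child.\<close>
  have flip: "c {v, w} = Some b" if "(v, w) \<in> C" "kempe C v w b (the (c0 {v, w})) c0 = c" for w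
    using kempe_swap.kempe_vw[OF swap_restrictedI[OF d that(1)]] that(2) by (simp add: c0_def b)
  show ?thesis
  proof (cases "\<exists>w. (v, w) \<in> C \<and> c {v, w} = Some b")
    case False
    then have "(\<Sum>w\<in>children. indicat_real {c} (kempe C v w b (the (c0 {v, w})) c0) :: real) = 0"
      using flip by (intro sum.neutral) (auto simp: indicator_def)
    moreover have "pmf (insert_color c b) d = indicat_real {c} c0"
      using False upd_iff[OF c] by (auto simp: insert_color_stop indicator_def)
    ultimately show ?thesis
      unfolding ins del using c0(2) by (auto simp: indicator_def)
  next
    case True
    then obtain w where w: "(v, w) \<in> C" "c {v, w} = Some b" by blast
    define a where "a = the (c0 {v, w})"
    \<comment> \<open>Color \<open>b\<close> is used at \<open>v\<close> by \<open>c\<close> but not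
      by \<open>c0\<close>, which removes the stopping term.\<close>
    have "c \<noteq> c0" using w(2) c0(3) by (auto simp: available_def)
    have "(\<Sum>w'\<in>children. indicat_real {c} (kempe C v w' b (the (c0 {v, w'})) c0) :: real) =
        (\<Sum>w'\<in>children. if w' = w then indicat_real {c} (kempe C v w b a c0) else 0)"
    proof (rule sum.cong[OF refl])
      fix w' assume w': "w' \<in> children"
      show "indicat_real {c} (kempe C v w' b (the (c0 {v, w'})) c0) =
          (if w' = w then indicat_real {c} (kempe C v w b a c0) else 0 :: real)"
      proof (cases "w' = w")
        case False
        then have "kempe C v w' b (the (c0 {v, w'})) c0 \<noteq> c"
          using flip[of w'] child_unique[OF c w, of w'] w' by blast
        then show ?thesis using False by simp
      qed (simp add: a_def)
    qed
    also have "\<dots> = indicat_real {c} (kempe C v w b a c0)"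
      using w(1) by (simp add: sum.delta[OF finite_children])
    finally have right: "pmf (delete_kernel d) c * real \<kappa> = indicat_real {c} (kempe C v w b a c0)"
      unfolding del using \<open>c \<noteq> c0\<close> by simp
    \<comment> \<open>The swap puts the drawn color on \<open>{v, w}\<close>, so only the draw equal
      to the color there in \<open>c0\<close> can produce \<open>d\<close>.\<close>
    have contrib: "indicat_real {d} ((kempe C v w a' b c)({u, v} \<mapsto> b)) =
        (if a' = a then indicat_real {c0} (kempe C v w a b c) else 0 :: real)"
      if a': "a' \<in> available \<kappa> c v" for a'
    proof -
      interpret kempe_swap C \<kappa> c v w a' b by (rule swapI[OF c w a'])
      have "a' = a" if "kempe C v w a' b c = c0" using kempe_vw unfolding that a_def by simp
      then show ?thesis using upd_iff[OF kempe_proper] by (cases "a' = a") auto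
    qed
    have "pmf (insert_color c b) d =
        (\<Sum>a'\<in>available \<kappa> c v. indicat_real {d} ((kempe C v w a' b c)({u, v} \<mapsto> b))) /
        real (\<kappa> - card children)"
      by (simp add: insert_color_flip[OF c w] pmf_map_pmf_of_set card_available_v[OF c]
          available_nonempty[OF c] finite_available)
    also have "(\<Sum>a'\<in>available \<kappa> c v. indicat_real {d} ((kempe C v w a' b c)({u, v} \<mapsto> b)) :: real) =
        (if a \<in> available \<kappa> c v then indicat_real {c0} (kempe C v w a b c) else 0)"
      by (simp add: contrib finite_available)
    finally have left: "pmf (insert_color c b) d * real (\<kappa> - card children) =
        (if a \<in> available \<kappa> c v then indicat_real {c0} (kempe C v w a b c) else 0)"
      using deg_v by (simp add: card_children)
    have "b \<in> available \<kappa> c u \<and> a \<in> available \<kappa> c v \<and> kempe C v w a b c = c0 \<longleftrightarrow>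
        kempe C v w b a c0 = c"
      using kempe_reverse[OF c d w b] by (simp only: c0_def a_def)
    then show ?thesis
      unfolding ins left right by (cases "kempe C v w b a c0 = c") auto
  qed
qed

lemma insert_kernel_uniform:
  assumes "P0 \<noteq> {}"
  shows "P1 \<noteq> {}" and "bind_pmf (pmf_of_set P0) insert_kernel = pmf_of_set P1"
proof -
  have *: "0 < real ((\<kappa> - degree (edges C) u) * (\<kappa> - card children))"
    using deg_u deg_v by (simp add: card_children)
  show "P1 \<noteq> {}" "bind_pmf (pmf_of_set P0) insert_kernel = pmf_of_set P1"
    using uniform_of_detailed_balance[of P0 P1 insert_kernel delete_kernel, OF _ assms _
        insert_kernel_support delete_kernel_support detailed_balance *] finite_edges[OF C]
    by (simp_all add: finite_proper_colorings)
qed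

lemma delete_kernel_uniform:
  assumes "P1 \<noteq> {}"
  shows "P0 \<noteq> {}" and "bind_pmf (pmf_of_set P1) delete_kernel = pmf_of_set P0"
proof -
  have *: "0 < real \<kappa>" using deg_u by simp
  show "P0 \<noteq> {}" "bind_pmf (pmf_of_set P1) delete_kernel = pmf_of_set P0"
    using uniform_of_detailed_balance[of P1 P0 delete_kernel insert_kernel, OF _ assms _
        delete_kernel_support insert_kernel_support detailed_balance[symmetric] *] finite_edges[OF C]
    by (simp_all add: finite_proper_colorings)
qed

section \<open>Agreement of the algorithm with the kernels\<close>

lemma arborescence_joined: "arborescence (insert (u, v) C)"
  by (rule arborescence_attach[OF C root u])

lemma u_not_below: "(v, x) \<in> C\<^sup>* \<Longrightarrow> x \<noteq> u"
  using u descendant_component by metis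

lemma child_joined:
  "child (insert {u, v} (edges C)) (- Range (insert (u, v) C)) x y \<longleftrightarrow> (x, y) \<in> insert (u, v) C"
  using child_iff[OF arborescence_joined] by (simp only: edges_insert)

text \<open>The repair runs in the joined forest, but \<open>u\<close> is not below
  \<open>v\<close>, so the children met by the recursion are those in \<open>C\<close>.\<close>

lemma insert_step_eq:
  assumes c: "c \<in> P0" and ends: "name_ends \<Delta> tie (edges C) x y = (u, v)"
    and R: "R - component (edges C) v = - Range (insert (u, v) C)"
  shows "insert_step \<kappa> \<Delta> tie x y (edges C, R, c) =
    map_pmf (\<lambda>d. (insert {u, v} (edges C), - Range (insert (u, v) C), d)) (insert_kernel c)"
proof -
  let ?E = "insert {u, v} (edges C)" and ?R = "- Range (insert (u, v) C)"
  have child: "child ?E ?R v w \<and> (c({u, v} \<mapsto> b)) {v, w} = Some b' \<longleftrightarrow>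
      (v, w) \<in> C \<and> c {v, w} = Some b'" for w b b'
    unfolding child_joined using u_neq_v uv_new by (auto simp: edges_iff)
  have flip: "fix_forbidden ?E ?R w b a (c({u, v} \<mapsto> b, {v, w} \<mapsto> a)) =
      (kempe C v w a b c)({u, v} \<mapsto> b)"
    if w: "(v, w) \<in> C" "c {v, w} = Some b" and a: "a \<in> available \<kappa> c v" for a b w
  proof
    fix e
    interpret kempe_swap C \<kappa> c v w a b by (rule swapI[OF c w a])
    have vw_mem: "{v, w} \<in> edges C" using w(1) by (simp add: edges_iff)
    have "fix_forbidden ?E ?R w b a (c({u, v} \<mapsto> b, {v, w} \<mapsto> a)) e =
        (if e \<in> edges C then kempe C v w a b c e else (c({u, v} \<mapsto> b, {v, w} \<mapsto> a)) e)"
    proof (rule fix_forbidden_eq_kempe)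
      fix p q assume "(w, p) \<in> C\<^sup>*"
      then have "(v, p) \<in> C\<^sup>*" using w(1) by (rule converse_rtrancl_into_rtrancl[rotated])
      then show "child ?E ?R p q \<longleftrightarrow> (p, q) \<in> C" using child_joined u_not_below by auto
    qed (use uv_new in auto)
    also have "\<dots> = ((kempe C v w a b c)({u, v} \<mapsto> b)) e"
      using uv_new vw_mem proper_coloringsD(2)[OF c, of e] proper_coloringsD(2)[OF kempe_proper, of e]
      by auto
    finally show "fix_forbidden ?E ?R w b a (c({u, v} \<mapsto> b, {v, w} \<mapsto> a)) e =
      ((kempe C v w a b c)({u, v} \<mapsto> b)) e" .
  qed
  \<comment> \<open>The algorithm draws the second color after coloring \<open>{u, v}\<close>. As a
    child edge already has that color, the set of colors used at \<open>v\<close> is the same as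
    before.\<close>
  have avail: "available \<kappa> (c({u, v} \<mapsto> b)) v = available \<kappa> c v"
    if w: "(v, w) \<in> C" "c {v, w} = Some b" for w b
  proof -
    have "(\<exists>e. v \<in> e \<and> (c({u, v} \<mapsto> b)) e = Some a) \<longleftrightarrow> (\<exists>e. v \<in> e \<and> c e = Some a)" for a
    proof
      assume "\<exists>e. v \<in> e \<and> (c({u, v} \<mapsto> b)) e = Some a"
      then obtain e where e: "v \<in> e" "(c({u, v} \<mapsto> b)) e = Some a" by blast
      show "\<exists>e. v \<in> e \<and> c e = Some a"
      proof (cases "e = {u, v}")
        case True
        then show ?thesis using e(2) w(2) by (intro exI[of _ "{v, w}"]) simp
      next
        case False
        then show ?thesis using e by (intro exI[of _ e]) simp
      qed
    next
      assume "\<exists>e. v \<in> e \<and> c e = Some a"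
      then obtain e where e: "v \<in> e" "c e = Some a" by blast
      then have "e \<noteq> {u, v}" using uncolored_uv[OF c] by auto
      then show "\<exists>e. v \<in> e \<and> (c({u, v} \<mapsto> b)) e = Some a"
        using e by (intro exI[of _ e]) simp
    qed
    then show ?thesis by (simp only: available_def)
  qed
  show ?thesis
    unfolding insert_step_def insert_kernel_def split_conv ends Let_def R child map_bind_pmf
  proof (intro bind_pmf_cong refl)
    fix b
    show "(if \<nexists>w. (v, w) \<in> C \<and> c {v, w} = Some b then return_pmf (?E, ?R, c({u, v} \<mapsto> b))
        else bind_pmf (pmf_of_set (available \<kappa> (c({u, v} \<mapsto> b)) v)) (\<lambda>a. return_pmf (?E, ?R,
          fix_forbidden ?E ?R (THE w. (v, w) \<in> C \<and> c {v, w} = Some b) b a (c({u, v} \<mapsto> b,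
            {v, THE w. (v, w) \<in> C \<and> c {v, w} = Some b} \<mapsto> a))))) =
      map_pmf (\<lambda>d. (?E, ?R, d)) (insert_color c b)"
    proof (cases "\<exists>w. (v, w) \<in> C \<and> c {v, w} = Some b")
      case False
      then show ?thesis by (simp add: insert_color_stop)
    next
      case True
      then obtain w where w: "(v, w) \<in> C" "c {v, w} = Some b" by blast
      then have ex: "(\<nexists>w. (v, w) \<in> C \<and> c {v, w} = Some b) = False" by blast
      have "bind_pmf (pmf_of_set (available \<kappa> c v)) (\<lambda>a. return_pmf (?E, ?R,
            fix_forbidden ?E ?R w b a (c({u, v} \<mapsto> b, {v, w} \<mapsto> a)))) =
          map_pmf (\<lambda>a. (?E, ?R, (kempe C v w a b c)({u, v} \<mapsto> b))) (pmf_of_set (available \<kappa> c v))"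
        unfolding map_pmf_def
        by (intro bind_pmf_cong refl) (simp only: set_pmf_available[OF c] flip[OF w])
      then show ?thesis
        by (simp only: ex if_False the_child[OF c w] avail[OF w] insert_color_flip[OF c w] map_pmf_comp)
    qed
  qed
qed

lemma delete_step_eq:
  assumes d: "d \<in> P1" and xy: "(x, y) = (u, v) \<or> (x, y) = (v, u)"
  shows "delete_step \<kappa> x y (insert {u, v} (edges C), - Range (insert (u, v) C), d) =
    map_pmf (\<lambda>c. (edges C, - Range C, c)) (delete_kernel d)"
proof -
  have vu: "(v, u) \<notin> insert (u, v) C"
  proof
    assume "(v, u) \<in> insert (u, v) C"
    then have "(v, u) \<in> C\<^sup>*" using u_neq_v by simp
    then show False using u_not_below by blast
  qed
  \<comment> \<open>Whichever order the update names the ends in, the rooting selects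
    \<open>u\<close> as the parent.\<close>
  have ends: "(if child (insert {u, v} (edges C)) (- Range (insert (u, v) C)) x y
      then (x, y) else (y, x)) = (u, v)"
    unfolding child_joined using xy vu by (elim disjE) simp_all
  have E: "insert {u, v} (edges C) - {{u, v}} = edges C" using uv_new by auto
  have R: "insert v (- Range (insert (u, v) C)) = - Range C" using root by auto
  define c where "c = d({u, v} := None)"
  define a where "a = the (d {u, v})"
  have flip: "fix_forbidden (edges C) (- Range C) w (the (c {v, w})) a (c({v, w} \<mapsto> a)) =
      kempe C v w a (the (c {v, w})) c" if w: "(v, w) \<in> C" for w
  proof
    fix e
    interpret kempe_swap C \<kappa> c v w a "the (c {v, w})"
      using swap_restrictedI[OF d w] by (simp only: c_def a_def)
    have "fix_forbidden (edges C) (- Range C) w (the (c {v, w})) a (c({v, w} \<mapsto> a)) e =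
        (if e \<in> edges C then kempe C v w a (the (c {v, w})) c e else (c({v, w} \<mapsto> a)) e)"
      by (rule fix_forbidden_eq_kempe) (use child_iff[OF C] in auto)
    also have "\<dots> = kempe C v w a (the (c {v, w})) c e"
      using w proper_coloringsD(2)[OF proper_colorings_restrict(1)[OF d uv_new], of e]
        proper_coloringsD(2)[OF kempe_proper, of e]
      by (auto simp: edges_iff c_def)
    finally show "fix_forbidden (edges C) (- Range C) w (the (c {v, w})) a (c({v, w} \<mapsto> a)) e =
      kempe C v w a (the (c {v, w})) c e" .
  qed
  show ?thesis
    unfolding delete_step_def delete_kernel_def split_conv ends Let_def E R map_bind_pmf
      child_iff[OF C] c_def[symmetric] a_def[symmetric]
  proof (intro bind_pmf_cong refl)
    fix stop
    assume stop: "stop \<in> set_pmf (bernoulli_pmf ((real \<kappa> - real (card children)) / real \<kappa>))"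
    show "(if stop then return_pmf (edges C, - Range C, c)
        else bind_pmf (pmf_of_set children) (\<lambda>w. return_pmf (edges C, - Range C,
          fix_forbidden (edges C) (- Range C) w (the (c {v, w})) a (c({v, w} \<mapsto> a))))) =
      map_pmf (\<lambda>c. (edges C, - Range C, c)) (if stop then return_pmf c
        else map_pmf (\<lambda>w. kempe C v w a (the (c {v, w})) c) (pmf_of_set children))"
    proof (cases stop)
      case False
      then have "1 - (real \<kappa> - real (card children)) / real \<kappa> \<noteq> 0"
        using stop pmf_bernoulli_False[OF stop_probability(1,2)] by (simp add: set_pmf_iff)
      then have "children \<noteq> {}" unfolding stop_probability(3) by (metis card.empty div_0 of_nat_0)
      then have "set_pmf (pmf_of_set children) = children" using finite_children by simp
      then have "bind_pmf (pmf_of_set children) (\<lambda>w. return_pmf (edges C, - Range C,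
            fix_forbidden (edges C) (- Range C) w (the (c {v, w})) a (c({v, w} \<mapsto> a)))) =
          bind_pmf (pmf_of_set children) (\<lambda>w. return_pmf (edges C, - Range C,
            kempe C v w a (the (c {v, w})) c))"
        using flip by (intro bind_pmf_cong refl) simp
      then show ?thesis
        using False by (simp add: map_pmf_def bind_assoc_pmf bind_return_pmf)
    qed simp
  qed
qed

end

section \<open>The uniform invariant\<close>

text \<open>Only the coloring is random: the choice of ends and of roots ignores the colors, so the
  rooted forest is determined by the updates and the rule for ties.\<close>

definition uniform_state :: "nat \<Rightarrow> 'v rel \<Rightarrow> 'v state pmf" where
  "uniform_state \<kappa> C =
     map_pmf (\<lambda>c. (edges C, - Range C, c)) (pmf_of_set (proper_colorings \<kappa> (edges C)))"

lemma insert_step_uniform: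
  assumes C: "arborescence C" and nonempty: "proper_colorings \<kappa> (edges C) \<noteq> {}"
    and valid: "valid_update \<Delta> (edges C) (Insert x y)" and "\<Delta> \<le> \<kappa>"
  shows "\<exists>D. arborescence D \<and> edges D = insert {x, y} (edges C) \<and>
    proper_colorings \<kappa> (edges D) \<noteq> {} \<and>
    bind_pmf (uniform_state \<kappa> C) (insert_step \<kappa> \<Delta> tie x y) = uniform_state \<kappa> D"
proof -
  obtain u v where ends: "name_ends \<Delta> tie (edges C) x y = (u, v)" by fastforce
  then have uv: "(u, v) = (x, y) \<or> (u, v) = (y, x)"
    by (auto simp: name_ends_def Let_def split: if_splits)
  then have uv_xy: "{u, v} = {x, y}" by auto
  \<comment> \<open>Rerooting at \<open>v\<close> serves the analysis; the state itself still
    carries the old roots \<open>- Range C\<close>.\<close>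
  obtain B where B: "arborescence B" "edges B = edges C"
    "- Range B = insert v (- Range C - component (edges C) v)" using reroot_exists[OF C] by blast
  have u: "u \<notin> component (edges C) v"
    using valid uv component_sym[of u "edges C" v] by auto
  have deg: "degree (edges C) z < \<kappa>" if "z \<in> {u, v}" for z
  proof -
    have "finite (edges C)" using C by (rule finite_edges)
    moreover have "{u, v} \<notin> edges C"
      using u component_eqI[of u v "edges C"] component_refl by metis
    ultimately have "Suc (degree (edges C) z) = degree (insert {x, y} (edges C)) z"
      using degree_insert_edge[OF _ _ that, of "edges C"] by (simp add: uv_xy)
    also have "\<dots> \<le> \<Delta>" using valid by simp
    finally show ?thesis using \<open>\<Delta> \<le> \<kappa>\<close> by simp
  qed
  interpret attach B u v \<kappa>
    using B u deg by unfold_locales auto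
  \<comment> \<open>Rerooting changed the roots only inside the tree of \<open>v\<close>, and the
    joined forest has no root there.\<close>
  have R: "- Range C - component (edges B) v = - Range (insert (u, v) B)"
  proof -
    have "- Range (insert (u, v) B) = - Range B - {v}" by auto
    then show ?thesis using B(2,3) component_refl[of v "edges C"] by auto
  qed
  have P0: "P0 \<noteq> {}" using nonempty B(2) by simp
  have fin: "finite P0" using finite_edges[OF B(1)] by (rule finite_proper_colorings)
  let ?F = "\<lambda>d. (insert {u, v} (edges B), - Range (insert (u, v) B), d)"
  have "bind_pmf (uniform_state \<kappa> C) (insert_step \<kappa> \<Delta> tie x y) =
      bind_pmf (pmf_of_set P0) (\<lambda>c. insert_step \<kappa> \<Delta> tie x y (edges B, - Range C, c))"
    by (simp add: uniform_state_def bind_map_pmf B(2))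
  also have "\<dots> = bind_pmf (pmf_of_set P0) (\<lambda>c. map_pmf ?F (insert_kernel c))"
    using insert_step_eq[OF _ ends[folded B(2)] R] P0 fin by (intro bind_pmf_cong refl) simp
  also have "\<dots> = map_pmf ?F (pmf_of_set P1)"
    by (simp add: map_bind_pmf[symmetric] insert_kernel_uniform(2)[OF P0])
  also have "\<dots> = uniform_state \<kappa> (insert (u, v) B)"
    by (simp add: uniform_state_def edges_insert)
  finally have "bind_pmf (uniform_state \<kappa> C) (insert_step \<kappa> \<Delta> tie x y) =
    uniform_state \<kappa> (insert (u, v) B)" .
  moreover have "edges (insert (u, v) B) = insert {x, y} (edges C)"
    by (simp add: edges_insert B(2) uv_xy)
  moreover have "proper_colorings \<kappa> (edges (insert (u, v) B)) \<noteq> {}"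
    using insert_kernel_uniform(1)[OF P0] by (simp add: edges_insert)
  ultimately show ?thesis using arborescence_joined by blast
qed

lemma delete_step_uniform:
  assumes C: "arborescence C" and nonempty: "proper_colorings \<kappa> (edges C) \<noteq> {}"
    and xy: "{x, y} \<in> edges C" and deg: "\<And>z. degree (edges C) z \<le> \<kappa>"
  shows "\<exists>D. arborescence D \<and> edges D = edges C - {{x, y}} \<and>
    proper_colorings \<kappa> (edges D) \<noteq> {} \<and>
    bind_pmf (uniform_state \<kappa> C) (delete_step \<kappa> x y) = uniform_state \<kappa> D"
proof -
  obtain u v where uvC: "(u, v) \<in> C" and uv: "(x, y) = (u, v) \<or> (x, y) = (v, u)"
    using xy by (auto simp: edges_iff)
  then have uv_xy: "{x, y} = {u, v}" by auto
  define D where "D = C - {(u, v)}"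
  have CD: "C = insert (u, v) D" using uvC by (auto simp: D_def)
  have D: "arborescence D" using C by (rule arborescence_subset) (auto simp: D_def)
  have root: "v \<notin> Range D" using arborescence_parent[OF C uvC] by (auto simp: D_def)
  have u: "u \<notin> component (edges D) v"
  proof
    assume "u \<in> component (edges D) v"
    then have "(v, u) \<in> D\<^sup>*" by (rule component_root[OF D root])
    then have "(v, u) \<in> C\<^sup>*" using rtrancl_mono[of D C] by (auto simp: D_def)
    then show False using arborescence_no_cycle[OF C uvC] by simp
  qed
  have new: "{u, v} \<notin> edges D"
    using u component_eqI[of u v "edges D"] component_refl by metis
  have edges_C: "edges C = insert {u, v} (edges D)" unfolding CD by (rule edges_insert)
  have "degree (edges D) z < \<kappa>" if "z \<in> {u, v}" for z
  proof -
    have "finite (edges D)" using D by (rule finite_edges)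
    then have "Suc (degree (edges D) z) = degree (edges C) z"
      using degree_insert_edge[OF _ new that] by (simp add: edges_C)
    then show ?thesis using deg[of z] by simp
  qed
  then interpret attach D u v \<kappa>
    using D root u by unfold_locales auto
  have P1: "P1 \<noteq> {}" using nonempty by (simp add: edges_C)
  have fin: "finite P1" using finite_edges[OF D] by (simp add: finite_proper_colorings)
  have "bind_pmf (uniform_state \<kappa> C) (delete_step \<kappa> x y) = bind_pmf (pmf_of_set P1)
      (\<lambda>d. delete_step \<kappa> x y (insert {u, v} (edges D), - Range (insert (u, v) D), d))"
    unfolding uniform_state_def bind_map_pmf edges_C by (simp only: CD[symmetric])
  also have "\<dots> = bind_pmf (pmf_of_set P1)
      (\<lambda>d. map_pmf (\<lambda>c. (edges D, - Range D, c)) (delete_kernel d))"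
    using delete_step_eq[OF _ uv] P1 fin by (intro bind_pmf_cong refl) simp
  also have "\<dots> = uniform_state \<kappa> D"
    by (simp add: map_bind_pmf[symmetric] delete_kernel_uniform(2)[OF P1] uniform_state_def)
  finally have "bind_pmf (uniform_state \<kappa> C) (delete_step \<kappa> x y) = uniform_state \<kappa> D" .
  moreover have "edges D = edges C - {{x, y}}" using new by (auto simp: edges_C uv_xy)
  ultimately show ?thesis using D delete_kernel_uniform(1)[OF P1] by metis
qed

text \<open>The invariant also carries the degree bound, which a valid deletion does not restate,
  and the existence of a proper coloring, without which \<open>pmf_of_set\<close> would be
  unspecified.\<close>

lemma dist_maint_uniform:
  assumes "\<Delta> \<le> \<kappa>" and valid: "valid_updates \<Delta> us" and "t \<le> length us"
  shows "\<exists>C. arborescence C \<and> edges C = forest us t \<and> (\<forall>x. degree (edges C) x \<le> \<Delta>) \<and>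
    proper_colorings \<kappa> (edges C) \<noteq> {} \<and> dist_maint \<kappa> \<Delta> tie us t = uniform_state \<kappa> C"
  using \<open>t \<le> length us\<close>
proof (induction t)
  case 0
  have empty: "proper_colorings \<kappa> {} = {Map.empty}" by (auto simp: proper_colorings_def)
  show ?case
    by (intro exI[of _ "{}"])
      (simp add: arborescence_def acyclic_def edges_def degree_def uniform_state_def empty pmf_of_set_singleton)
next
  case (Suc t)
  obtain C where C: "arborescence C" "edges C = forest us t"
    "\<forall>x. degree (edges C) x \<le> \<Delta>" "proper_colorings \<kappa> (edges C) \<noteq> {}"
    "dist_maint \<kappa> \<Delta> tie us t = uniform_state \<kappa> C"
    using Suc.IH[OF Suc_leD[OF Suc.prems]] by blast
  have upd: "valid_update \<Delta> (edges C) (us ! t)"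
    using valid Suc.prems C(2) by (simp add: valid_updates_def)
  show ?case
  proof (cases "us ! t")
    case (Insert x y)
    have ins: "valid_update \<Delta> (edges C) (Insert x y)" using upd Insert by simp
    then have "degree (insert {x, y} (edges C)) z \<le> \<Delta>" for z by simp
    then show ?thesis
      using insert_step_uniform[OF C(1,4) ins \<open>\<Delta> \<le> \<kappa>\<close>, of "tie (take t us)"] C(2,5) Insert by auto
  next
    case (Delete x y)
    have "{x, y} \<in> edges C" using upd Delete by simp
    moreover have "degree (edges C) z \<le> \<kappa>" for z using C(3) \<open>\<Delta> \<le> \<kappa>\<close> le_trans by blast
    ultimately obtain D where D: "arborescence D" "edges D = edges C - {{x, y}}"
      "proper_colorings \<kappa> (edges D) \<noteq> {}"
      "bind_pmf (uniform_state \<kappa> C) (delete_step \<kappa> x y) = uniform_state \<kappa> D"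
      using delete_step_uniform[OF C(1,4)] by blast
    have "finite (edges C)" using C(1) by (rule finite_edges)
    then have "degree (edges D) z \<le> \<Delta>" for z
      using degree_mono[of "edges C" "edges D" z] C(3) D(2) le_trans by blast
    then show ?thesis using D C(2,5) Delete by auto
  qed
qed

theorem theorem4p8:
  fixes \<kappa> \<Delta> t :: nat
    and us :: "'v update list"
    and tie :: "'v update list \<Rightarrow> 'v \<Rightarrow> 'v \<Rightarrow> bool"
  assumes "2 \<le> \<Delta>" and "\<Delta> \<le> \<kappa>"
    and "valid_updates \<Delta> us" and "t \<le> length us"
  shows "dist_maint_coloring \<kappa> \<Delta> tie us t = pmf_of_set (proper_colorings \<kappa> (forest us t))"
proof -
  obtain C where "edges C = forest us t" "dist_maint \<kappa> \<Delta> tie us t = uniform_state \<kappa> C"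
    using dist_maint_uniform[OF assms(2-4)] by blast
  then show ?thesis
    by (simp add: dist_maint_coloring_def uniform_state_def map_pmf_comp)
qed

end
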